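(* Let $\Sigma$ be a discrete-time linear system given by bounded Hilbert space operators $(A,B,C,D)$. Assume that $\Sigma$ is minimal and that its transfer function $F_\Sigma$ has an analytic continuation to a function in the Schur class $\mathcal S(\mathcal U,\mathcal Y)$. Let $S_a$ be the available storage and $\underline S_r$ the $\ell^2$-regularized required supply. Then: (1) $S_a$ and $\underline S_r$ are $\ell^2$-regular storage functions for $\Sigma$. (2) If $S$ is another $\ell^2$-regular storage function for $\Sigma$ such that either (a) $S$ is $\mathcal D(\mathbf W_c^* )$-weakly continuous in the sense that: given a sequence $\{x_n\}\subset\mathrm{Im}\,\mathbf W_c$ and $x_c\in\mathrm{Im}\,\mathbf W_c$ such that $\lim_{n\to\infty}\langle x,x_n\rangle=\langle x,x_c\rangle$ for all $x\in\mathcal D(\mathbf W_c^* )$, then $\lim_{n\to\infty}S(x_n)=S(x_c)$; or (b) $\mathbf W_c$ is bounded and $S$ is continuous on $\mathcal X$ with respect to the norm topology of $\mathcal X$, then $S(x_0)\le\underline S_r(x_0)$ for all $x_0\in\mathcal X$.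
   Context: System: $\mathcal U,\mathcal X,\mathcal Y$ Hilbert spaces, $A:\mathcal X\to\mathcal X$, $B:\mathcal U\to\mathcal X$, $C:\mathcal X\to\mathcal Y$, $D:\mathcal U\to\mathcal Y$ bounded; system trajectories satisfy $\mathbf x(n+1)=A\mathbf x(n)+B\mathbf u(n)$, $\mathbf y(n)=C\mathbf x(n)+D\mathbf u(n)$; $F_\Sigma(\lambda)=D+\lambda C(I-\lambda A)^{-1}B$ near $0$. $\mathcal S(\mathcal U,\mathcal Y)$: holomorphic $F:\mathbb D\to\mathcal L(\mathcal U,\mathcal Y)$ with $\|F(\lambda)\|\le1$ on $\mathbb D$. Minimal: the linear spans of $\{\mathrm{Im}\,A^kB\}_{k\ge0}$ and of $\{\mathrm{Im}\,A^{*k}C^*\}_{k\ge0}$ are both dense in $\mathcal X$. $\mathbb Z_-=\{-1,-2,\dots\}$. $\mathbf W_c^*$ has domain $\mathcal D(\mathbf W_c^* )=\{x\in\mathcal X:\{B^*A^{*(-n-1)}x\}_{n\le-1}\in\ell^2_{\mathcal U}(\mathbb Z_-)\}$ and action $\mathbf W_c^*x=\{B^*A^{*(-n-1)}x\}_{n\le-1}$; under the assumptions it is closed and densely defined, and $\mathbf W_c:=(\mathbf W_c^* )^*$ is its adjoint, $\mathrm{Im}\,\mathbf W_c=\mathbf W_c\mathcal D(\mathbf W_c)$. With $F_0=D$, $F_n=CA^{n-1}B$ ($n\ge1$), $\widetilde{\mathfrak T}_{F_\Sigma}=[F_{i-j}]_{j\le i<0}:\ell^2_{\mathcal U}(\mathbb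 Z_-)\to\ell^2_{\mathcal Y}(\mathbb Z_-)$ is the (contractive, block lower triangular) Toeplitz operator. A storage function for $\Sigma$ is a function $S:\mathcal X\to[0,\infty]$ with $S(0)=0$ and $S(\mathbf x(n+1))\le S(\mathbf x(n))+\|\mathbf u(n)\|^2-\|\mathbf y(n)\|^2$ ($n\ge N_0$) along all trajectories $(\mathbf u(n),\mathbf x(n),\mathbf y(n))_{n\ge N_0}$ started from an arbitrary state at an arbitrary $N_0\in\mathbb Z$. It is $\ell^2$-regular if $S(x_0)<\infty$ for all $x_0\in\mathrm{Im}\,\mathbf W_c$. Available storage: $S_a(x_0)=\sup\sum_{n=0}^{n_1}(\|\mathbf y(n)\|^2-\|\mathbf u(n)\|^2)$ over all $n_1\ge0$ and all trajectories $(\mathbf u(n),\mathbf x(n),\mathbf y(n))_{n\ge0}$ with $\mathbf x(0)=x_0$. $\ell^2$-regularized required supply: $\underline S_r(x_0)=\inf\{\|\mathbf u\|^2-\|\widetilde{\mathfrak T}_{F_\Sigma}\mathbf u\|^2:\mathbf u\in\mathcal D(\mathbf W_c),\ \mathbf W_c\mathbf u=x_0\}$, with value $+\infty$ if $x_0\notin\mathrm{Im}\,\mathbf W_c$. *)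

theory Defs
  imports "HOL-Analysis.Analysis"
begin

(* The real inner product that the class inherits is the real part of cinner, so norm,
   topology and completeness are those induced by cinner.  cinner is linear in its first
   and conjugate linear in its second argument.  Remaining axioms of a complex vector
   space and of an inner product follow from those of the real class. *)
class complex_hilbert = real_inner + banach +
  fixes scaleC :: "complex \<Rightarrow> 'a \<Rightarrow> 'a"  (infixr "*\<^sub>C" 75)
    and cinner :: "'a \<Rightarrow> 'a \<Rightarrow> complex"
  assumes scaleC_add_right: "a *\<^sub>C (x + y) = a *\<^sub>C x + a *\<^sub>C y"
    and scaleC_add_left: "(a + b) *\<^sub>C x = a *\<^sub>C x + b *\<^sub>C x"
    and scaleC_scaleC: "a *\<^sub>C b *\<^sub>C x = (a * b) *\<^sub>C x"
    and scaleR_scaleC: "r *\<^sub>R x = complex_of_real r *\<^sub>C x"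
    and cinner_commute: "cinner x y = cnj (cinner y x)"
    and cinner_add_left: "cinner (x + y) z = cinner x z + cinner y z"
    and cinner_scaleC_left: "cinner (a *\<^sub>C x) y = a * cinner x y"
    and inner_eq_Re_cinner: "inner x y = Re (cinner x y)"

instantiation complex :: complex_hilbert
begin

definition "scaleC (a :: complex) (x :: complex) = a * x"
definition "cinner (x :: complex) (y :: complex) = x * cnj y"

instance
  by standard
    (auto simp: scaleC_complex_def cinner_complex_def algebra_simps scaleR_conv_of_real
      inner_complex_def)

end

interpretation complex_vector: vector_space
  "scaleC :: complex \<Rightarrow> 'a \<Rightarrow> 'a :: complex_hilbert"
proof
  fix x :: 'a
  show "1 *\<^sub>C x = x"
    using scaleR_scaleC[of 1 x] by simp
qed (simp_all add: scaleC_add_right scaleC_add_left scaleC_scaleC)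

abbreviation cspan :: "'a :: complex_hilbert set \<Rightarrow> 'a set" where
  "cspan \<equiv> module.span scaleC"

definition bounded_clinear :: "('a :: complex_hilbert \<Rightarrow> 'b :: complex_hilbert) \<Rightarrow> bool" where
  "bounded_clinear T \<longleftrightarrow> bounded_linear T \<and> (\<forall>c x. T (c *\<^sub>C x) = c *\<^sub>C T x)"

definition cadjoint ::
    "('a :: complex_hilbert \<Rightarrow> 'b :: complex_hilbert) \<Rightarrow> 'b \<Rightarrow> 'a" where
  "cadjoint T = (THE T'. \<forall>x y. cinner (T x) y = cinner x (T' y))"

(* complex differentiability in the operator norm *)
definition operator_holomorphic_on ::
    "(complex \<Rightarrow> 'a :: complex_hilbert \<Rightarrow> 'b :: complex_hilbert) \<Rightarrow> complex set \<Rightarrow> bool" where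
  "operator_holomorphic_on F S \<longleftrightarrow>
     (\<forall>z\<in>S. bounded_clinear (F z)) \<and>
     (\<forall>z\<in>S. \<exists>F'. bounded_clinear F' \<and>
        ((\<lambda>w. onorm (\<lambda>u. (1 / (w - z)) *\<^sub>C (F w u - F z u) - F' u)) \<longlongrightarrow> 0) (at z within S))"

definition schur_class ::
    "(complex \<Rightarrow> 'u :: complex_hilbert \<Rightarrow> 'y :: complex_hilbert) set" where
  "schur_class = {F. operator_holomorphic_on F (ball 0 1) \<and> (\<forall>z\<in>ball 0 1. onorm (F z) \<le> 1)}"

(* For small z the operator I - zA is bijective, so inv is its inverse. *)
definition transfer_function ::
    "('x :: complex_hilbert \<Rightarrow> 'x) \<Rightarrow> ('u \<Rightarrow> 'x) \<Rightarrow> ('x \<Rightarrow> 'y) \<Rightarrow> ('u \<Rightarrow> 'y) \<Rightarrow> complex \<Rightarrow>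
      'u :: complex_hilbert \<Rightarrow> 'y :: complex_hilbert" where
  "transfer_function A B C D z u = D u + z *\<^sub>C C (inv (\<lambda>x. x - z *\<^sub>C A x) (B u))"

definition has_schur_continuation ::
    "(complex \<Rightarrow> 'u :: complex_hilbert \<Rightarrow> 'y :: complex_hilbert) \<Rightarrow> bool" where
  "has_schur_continuation G \<longleftrightarrow> (\<exists>F\<in>schur_class. \<forall>\<^sub>F z in nhds 0. F z = G z)"

definition minimal_system ::
    "('x :: complex_hilbert \<Rightarrow> 'x) \<Rightarrow> ('u :: complex_hilbert \<Rightarrow> 'x) \<Rightarrow> ('x \<Rightarrow> 'y :: complex_hilbert) \<Rightarrow> bool" where
  "minimal_system A B C \<longleftrightarrow>
     closure (cspan (\<Union>k. range (\<lambda>u. (A ^^ k) (B u)))) = UNIV \<and>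
     closure (cspan (\<Union>k. range (\<lambda>y. (cadjoint A ^^ k) (cadjoint C y)))) = UNIV"

(* Only the indices n \<ge> N0 of the two-sided sequences matter. *)
definition trajectory ::
    "('x :: complex_hilbert \<Rightarrow> 'x) \<Rightarrow> ('u :: complex_hilbert \<Rightarrow> 'x) \<Rightarrow> ('x \<Rightarrow> 'y) \<Rightarrow> ('u \<Rightarrow> 'y) \<Rightarrow> int \<Rightarrow>
      (int \<Rightarrow> 'u) \<Rightarrow> (int \<Rightarrow> 'x) \<Rightarrow> (int \<Rightarrow> 'y :: complex_hilbert) \<Rightarrow> bool" where
  "trajectory A B C D N0 u x y \<longleftrightarrow>
     (\<forall>n\<ge>N0. x (n + 1) = A (x n) + B (u n) \<and> y n = C (x n) + D (u n))"

(* Elements of l2 over the negative integers are represented by sequences on the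
   integers that vanish at the nonnegative indices. *)
definition l2_neg :: "(int \<Rightarrow> 'a :: complex_hilbert) set" where
  "l2_neg = {u. (\<forall>n\<ge>0. u n = 0) \<and> (\<lambda>n. (norm (u n))\<^sup>2) summable_on {..<0}}"

definition l2_neg_inner :: "(int \<Rightarrow> 'a :: complex_hilbert) \<Rightarrow> (int \<Rightarrow> 'a) \<Rightarrow> complex" where
  "l2_neg_inner u v = (\<Sum>\<^sub>\<infinity>n\<in>{..<0}. cinner (u n) (v n))"

definition l2_neg_norm :: "(int \<Rightarrow> 'a :: complex_hilbert) \<Rightarrow> real" where
  "l2_neg_norm u = sqrt (\<Sum>\<^sub>\<infinity>n\<in>{..<0}. (norm (u n))\<^sup>2)"

definition Wc_star ::
    "('x :: complex_hilbert \<Rightarrow> 'x) \<Rightarrow> ('u \<Rightarrow> 'x) \<Rightarrow> 'x \<Rightarrow> int \<Rightarrow> 'u :: complex_hilbert" where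
  "Wc_star A B x =
     (\<lambda>n. if n < 0 then cadjoint B ((cadjoint A ^^ nat (- n - 1)) x) else 0)"

definition dom_Wc_star ::
    "('x :: complex_hilbert \<Rightarrow> 'x) \<Rightarrow> ('u :: complex_hilbert \<Rightarrow> 'x) \<Rightarrow> 'x set" where
  "dom_Wc_star A B = {x. Wc_star A B x \<in> l2_neg}"

(* Hilbert space adjoint of the unbounded operator Wc_star with domain dom_Wc_star *)
definition dom_Wc ::
    "('x :: complex_hilbert \<Rightarrow> 'x) \<Rightarrow> ('u :: complex_hilbert \<Rightarrow> 'x) \<Rightarrow> (int \<Rightarrow> 'u) set" where
  "dom_Wc A B = {u \<in> l2_neg.
     \<exists>x0. \<forall>x\<in>dom_Wc_star A B. l2_neg_inner (Wc_star A B x) u = cinner x x0}"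

definition Wc ::
    "('x :: complex_hilbert \<Rightarrow> 'x) \<Rightarrow> ('u :: complex_hilbert \<Rightarrow> 'x) \<Rightarrow> (int \<Rightarrow> 'u) \<Rightarrow> 'x" where
  "Wc A B u =
     (THE x0. \<forall>x\<in>dom_Wc_star A B. l2_neg_inner (Wc_star A B x) u = cinner x x0)"

abbreviation Im_Wc ::
    "('x :: complex_hilbert \<Rightarrow> 'x) \<Rightarrow> ('u :: complex_hilbert \<Rightarrow> 'x) \<Rightarrow> 'x set" where
  "Im_Wc A B \<equiv> Wc A B ` dom_Wc A B"

definition Wc_bounded ::
    "('x :: complex_hilbert \<Rightarrow> 'x) \<Rightarrow> ('u :: complex_hilbert \<Rightarrow> 'x) \<Rightarrow> bool" where
  "Wc_bounded A B \<longleftrightarrow> (\<exists>M. \<forall>u\<in>dom_Wc A B. norm (Wc A B u) \<le> M * l2_neg_norm u)"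

definition markov ::
    "('x :: complex_hilbert \<Rightarrow> 'x) \<Rightarrow> ('u \<Rightarrow> 'x) \<Rightarrow> ('x \<Rightarrow> 'y) \<Rightarrow> ('u \<Rightarrow> 'y) \<Rightarrow> nat \<Rightarrow>
      'u :: complex_hilbert \<Rightarrow> 'y :: complex_hilbert" where
  "markov A B C D k u = (if k = 0 then D u else C ((A ^^ (k - 1)) (B u)))"

definition toeplitz_neg ::
    "('x :: complex_hilbert \<Rightarrow> 'x) \<Rightarrow> ('u \<Rightarrow> 'x) \<Rightarrow> ('x \<Rightarrow> 'y) \<Rightarrow> ('u \<Rightarrow> 'y) \<Rightarrow>
      (int \<Rightarrow> 'u :: complex_hilbert) \<Rightarrow> int \<Rightarrow> 'y :: complex_hilbert" where
  "toeplitz_neg A B C D u =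
     (\<lambda>i. if i < 0 then \<Sum>\<^sub>\<infinity>j\<in>{..i}. markov A B C D (nat (i - j)) (u j) else 0)"

definition storage_function ::
    "('x :: complex_hilbert \<Rightarrow> 'x) \<Rightarrow> ('u :: complex_hilbert \<Rightarrow> 'x) \<Rightarrow> ('x \<Rightarrow> 'y :: complex_hilbert) \<Rightarrow>
      ('u \<Rightarrow> 'y) \<Rightarrow> ('x \<Rightarrow> ereal) \<Rightarrow> bool" where
  "storage_function A B C D S \<longleftrightarrow>
     (\<forall>x. 0 \<le> S x) \<and> S 0 = 0 \<and>
     (\<forall>N0 u x y. trajectory A B C D N0 u x y \<longrightarrow>
        (\<forall>n\<ge>N0. S (x (n + 1)) \<le> S (x n) + ereal ((norm (u n))\<^sup>2) - ereal ((norm (y n))\<^sup>2)))"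

definition l2_regular_storage_function ::
    "('x :: complex_hilbert \<Rightarrow> 'x) \<Rightarrow> ('u :: complex_hilbert \<Rightarrow> 'x) \<Rightarrow> ('x \<Rightarrow> 'y :: complex_hilbert) \<Rightarrow>
      ('u \<Rightarrow> 'y) \<Rightarrow> ('x \<Rightarrow> ereal) \<Rightarrow> bool" where
  "l2_regular_storage_function A B C D S \<longleftrightarrow>
     storage_function A B C D S \<and> (\<forall>x0\<in>Im_Wc A B. S x0 < \<infinity>)"

definition available_storage ::
    "('x :: complex_hilbert \<Rightarrow> 'x) \<Rightarrow> ('u :: complex_hilbert \<Rightarrow> 'x) \<Rightarrow> ('x \<Rightarrow> 'y :: complex_hilbert) \<Rightarrow>
      ('u \<Rightarrow> 'y) \<Rightarrow> 'x \<Rightarrow> ereal" where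
  "available_storage A B C D x0 =
     Sup {ereal (\<Sum>n\<in>{0..n1}. (norm (y n))\<^sup>2 - (norm (u n))\<^sup>2) | n1 u x y.
            0 \<le> n1 \<and> trajectory A B C D 0 u x y \<and> x 0 = x0}"

(* The infimum of the empty set is \<infinity> in ereal, which covers x0 outside Im_Wc. *)
definition l2_required_supply ::
    "('x :: complex_hilbert \<Rightarrow> 'x) \<Rightarrow> ('u :: complex_hilbert \<Rightarrow> 'x) \<Rightarrow> ('x \<Rightarrow> 'y :: complex_hilbert) \<Rightarrow>
      ('u \<Rightarrow> 'y) \<Rightarrow> 'x \<Rightarrow> ereal" where
  "l2_required_supply A B C D x0 =
     Inf {ereal ((l2_neg_norm u)\<^sup>2 - (l2_neg_norm (toeplitz_neg A B C D u))\<^sup>2) | u.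
            u \<in> dom_Wc A B \<and> Wc A B u = x0}"

definition dom_Wc_star_weakly_continuous ::
    "('x :: complex_hilbert \<Rightarrow> 'x) \<Rightarrow> ('u :: complex_hilbert \<Rightarrow> 'x) \<Rightarrow> ('x \<Rightarrow> ereal) \<Rightarrow> bool" where
  "dom_Wc_star_weakly_continuous A B S \<longleftrightarrow>
     (\<forall>xs. \<forall>xc\<in>Im_Wc A B.
        (\<forall>n::nat. xs n \<in> Im_Wc A B) \<longrightarrow>
        (\<forall>x\<in>dom_Wc_star A B. (\<lambda>n. cinner x (xs n)) \<longlonglongrightarrow> cinner x xc) \<longrightarrow>
        (\<lambda>n. S (xs n)) \<longlonglongrightarrow> S xc)"

end

theory Submission
  imports Defs "HOL-Complex_Analysis.Laurent_Convergence"
begin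

text \<open>
  Write \<open>F k\<close> for the Markov parameters of the system. Everything rests on two facts about them.

  The first is the energy inequality: over any finite time window, starting from the state \<open>0\<close>, the
  output has at most the energy of the input. The Schur function that continues the transfer function
  has the Markov parameters as its Taylor coefficients, so the bilinear form
  \<open>\<Sum>\<Sum> cinner (F (n - k) (u k)) (w n)\<close> is a limit of means of \<open>cinner (\<Phi> z (U z)) (W z)\<close> over circles,
  where \<open>U\<close> and \<open>W\<close> are the polynomials with coefficients \<open>u\<close> and \<open>w\<close>; contractivity of \<open>\<Phi> z\<close> bounds
  these means by \<open>(\<parallel>u\<parallel>\<^sup>2 + \<parallel>w\<parallel>\<^sup>2) / 2\<close>, and taking for \<open>w\<close> the output itself gives the inequality
  (\<open>schur_toeplitz_contraction_nat\<close>). It extends to square-summable inputs from the infinite past by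
  truncation (\<open>response_contraction\<close>).

  The second is that an input \<open>u\<close> with \<open>Wc u = x0\<close> acts on the future exactly as the state \<open>x0\<close> does:
  \<open>C (A^m x0) = \<Sum> F (m - j) (u j)\<close>, the sum being over \<open>j < 0\<close> (\<open>steers_free_response\<close>). Indeed the
  energy inequality puts the vectors \<open>A*^k C* y\<close> into the domain of \<open>Wc*\<close>; testing the equation
  \<open>Wc u = x0\<close> against them is the claim. By observability these vectors also make that domain dense, so
  that \<open>Wc\<close> is single-valued.

  Now let \<open>u\<close> steer to \<open>x0\<close> and append an arbitrary future trajectory that starts at \<open>x0\<close>. The energy
  inequality for the combined input says that the energy extracted in the future is at most
  \<open>\<parallel>u\<parallel>\<^sup>2 - \<parallel>T u\<parallel>\<^sup>2\<close>, that is, the available storage is at most the required supply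
  (\<open>available_storage_le_required_supply\<close>). This one inequality gives the nonnegativity of the required
  supply, the values of both functions at \<open>0\<close>, and the finiteness of the available storage on the image
  of \<open>Wc\<close>. The dissipation inequalities come from prepending one step to a future trajectory
  (\<open>available_storage_step\<close>) and from shifting a past input by one step and appending one value
  (\<open>required_supply_step\<close>).

  For the maximality of the required supply, let \<open>u\<close> steer to \<open>x0\<close> and cut it off before time \<open>-K\<close>. The
  truncated input drives the state \<open>0\<close> at time \<open>-K\<close> to a state \<open>x\<^sub>K\<close> at time \<open>0\<close>, so every storage
  function \<open>S\<close> satisfies \<open>S x\<^sub>K \<le> \<parallel>u\<^sub>K\<parallel>\<^sup>2 - \<parallel>T u\<^sub>K\<parallel>\<^sup>2\<close>. The \<open>x\<^sub>K\<close> converge to \<open>x0\<close> weakly against the domain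
  of \<open>Wc*\<close>, and in norm if \<open>Wc\<close> is bounded; under either continuity assumption the left side tends to
  \<open>S x0\<close>, and a Fatou argument handles the right side (\<open>storage_le_net_supply\<close>).
\<close>

section \<open>Complex Hilbert spaces and adjoints\<close>
lemma cinner_add_right: "cinner x (y + z) = cinner x y + cinner x z"
  by (metis cinner_add_left cinner_commute complex_cnj_add)

lemma cinner_scaleC_right: "cinner x (a *\<^sub>C y) = cnj a * cinner x y"
  by (metis cinner_scaleC_left cinner_commute complex_cnj_mult)

lemma scaleC_minus_one: "(-1) *\<^sub>C x = - (x :: 'a :: complex_hilbert)"
  using scaleR_scaleC[of "-1" x] by simp

lemma cinner_minus_left: "cinner (- x) y = - cinner x y"
  using cinner_scaleC_left[of "-1" x y] by (simp add: scaleC_minus_one)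

lemma cinner_minus_right: "cinner x (- y) = - cinner x y"
  using cinner_scaleC_right[of x "-1" y] by (simp add: scaleC_minus_one)

lemma cinner_diff_left: "cinner (x - y) z = cinner x z - cinner y z"
  using cinner_add_left[of x "-y" z] by (simp add: cinner_minus_left)

lemma cinner_diff_right: "cinner x (y - z) = cinner x y - cinner x z"
  using cinner_add_right[of x y "-z"] by (simp add: cinner_minus_right)

lemma cinner_zero_left [simp]: "cinner 0 x = 0"
  using cinner_diff_left[of 0 0 x] by simp

lemma cinner_zero_right [simp]: "cinner x 0 = 0"
  using cinner_diff_right[of x 0 0] by simp

lemma cinner_sum_left: "cinner (\<Sum>i\<in>I. f i) y = (\<Sum>i\<in>I. cinner (f i) y)"
  by (induction I rule: infinite_finite_induct) (auto simp: cinner_add_left)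

lemma cinner_sum_right: "cinner x (\<Sum>i\<in>I. f i) = (\<Sum>i\<in>I. cinner x (f i))"
  by (induction I rule: infinite_finite_induct) (auto simp: cinner_add_right)

lemma Re_cinner: "Re (cinner x y) = inner x y"
  by (simp add: inner_eq_Re_cinner)

lemma cinner_self: "cinner x x = complex_of_real ((norm x)\<^sup>2)"
proof -
  have "Im (cinner x x) = 0"
    using arg_cong[OF cinner_commute[of x x], of Im] by simp
  then show ?thesis
    by (simp add: complex_eq_iff Re_cinner power2_norm_eq_inner)
qed

lemma norm_scaleC: "norm (a *\<^sub>C x) = cmod a * norm (x :: 'a :: complex_hilbert)"
proof -
  have "cinner (a *\<^sub>C x) (a *\<^sub>C x) = (a * cnj a) * cinner x x"
    by (simp add: cinner_scaleC_left cinner_scaleC_right)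
  then have "complex_of_real ((norm (a *\<^sub>C x))\<^sup>2) = complex_of_real ((cmod a * norm x)\<^sup>2)"
    by (simp add: cinner_self complex_norm_square[symmetric] power_mult_distrib)
  then have "(norm (a *\<^sub>C x))\<^sup>2 = (cmod a * norm x)\<^sup>2"
    using of_real_eq_iff by blast
  then show ?thesis
    by (simp add: power2_eq_iff_nonneg)
qed

text \<open>Multiplying the first argument by a unimodular number makes the complex inner product
  nonnegative, so the complex Cauchy-Schwarz inequality follows from the real one.\<close>
lemma norm_cinner_le: "cmod (cinner x y) \<le> norm x * norm y"
proof (cases "cinner x y = 0")
  case False
  define a where "a = cnj (sgn (cinner x y))"
  have a: "cmod a = 1"
    using False by (simp add: a_def norm_sgn)
  have "a * cinner x y = complex_of_real (cmod (cinner x y))"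
    using False unfolding a_def
    by (simp add: sgn_eq mult.commute[of "cnj _"] complex_norm_square[symmetric] power2_eq_square)
  then have "cmod (cinner x y) = inner (a *\<^sub>C x) y"
    by (metis Re_cinner Re_complex_of_real cinner_scaleC_left)
  also have "\<dots> \<le> norm (a *\<^sub>C x) * norm y"
    by (rule norm_cauchy_schwarz)
  finally show ?thesis
    by (simp add: norm_scaleC a)
qed simp

lemma bounded_linear_cinner_left: "bounded_linear (\<lambda>x. cinner x y)"
proof (rule bounded_linear_intro[where K = "norm y"])
  show "cinner (r *\<^sub>R x) y = r *\<^sub>R cinner x y" for r x
    by (simp add: scaleR_scaleC cinner_scaleC_left scaleC_complex_def)
qed (use norm_cinner_le in \<open>auto simp: cinner_add_left\<close>)

lemma bounded_linear_cinner_right: "bounded_linear (\<lambda>y. cinner x y)"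
proof (rule bounded_linear_intro[where K = "norm x"])
  show "cinner x (r *\<^sub>R y) = r *\<^sub>R cinner x y" for r y
    by (simp add: scaleR_scaleC cinner_scaleC_right scaleC_complex_def)
qed (use norm_cinner_le[of x] in \<open>auto simp: cinner_add_right mult.commute\<close>)

lemma cinner_eq_imp_eq:
  assumes "\<And>x. cinner x y = cinner x z"
  shows "y = z"
proof -
  have "cinner (y - z) (y - z) = 0"
    using assms by (simp add: cinner_diff_right)
  then show ?thesis
    by (simp add: cinner_self)
qed

text \<open>The Riesz representative of \<open>\<phi>\<close> is found as the minimizer of
  \<open>norm v ^ 2 - 2 \<phi> v\<close>: by the parallelogram law every minimizing sequence is Cauchy, and the
  vanishing of the first variation at the minimizer \<open>v\<close> says \<open>\<phi> h = inner h v\<close>.\<close>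
lemma riesz_representation:
  fixes \<phi> :: "'a :: {real_inner, banach} \<Rightarrow> real"
  assumes "bounded_linear \<phi>"
  shows "\<exists>v. \<forall>h. \<phi> h = inner h v"
proof -
  interpret \<phi>: bounded_linear \<phi> by fact
  define J where "J v = (norm v)\<^sup>2 - 2 * \<phi> v" for v
  define m where "m = (INF v. J v)"
  obtain K where K: "\<And>x. norm (\<phi> x) \<le> norm x * K"
    using \<phi>.bounded by blast
  have low: "- K\<^sup>2 \<le> J v" for v
  proof -
    have "0 \<le> (norm v - K)\<^sup>2" by simp
    then show ?thesis
      using K[of v] by (simp add: J_def power2_diff abs_le_iff algebra_simps)
  qed
  have bdd: "bdd_below (range J)"
    using low by (auto intro!: bdd_belowI)
  have m_le: "m \<le> J v" for v
    unfolding m_def by (rule cINF_lower[OF bdd]) simp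
  have para: "(norm (a - b))\<^sup>2 \<le> 2 * (J a - m) + 2 * (J b - m)" for a b
  proof -
    have "J a + J b - 2 * J ((1/2) *\<^sub>R (a + b)) = (norm (a - b))\<^sup>2 / 2"
      unfolding J_def
      by (simp add: \<phi>.scaleR \<phi>.add power2_norm_eq_inner inner_add_left inner_add_right
          inner_diff_left inner_diff_right inner_commute field_simps)
    then show ?thesis
      using m_le[of "(1/2) *\<^sub>R (a + b)"] by simp
  qed
  have "\<exists>v. J v < m + inverse (real (Suc n))" for n
    using cINF_less_iff[OF _ bdd, of "m + inverse (real (Suc n))"]
    unfolding m_def by auto
  then obtain s where s: "\<And>n. J (s n) < m + inverse (real (Suc n))"
    by metis
  have "Cauchy s"
  proof (rule metric_CauchyI)
    fix e :: real
    assume "e > 0"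
    then obtain n where n: "inverse (real (Suc n)) < e\<^sup>2 / 4"
      using reals_Archimedean[of "e\<^sup>2 / 4"] by auto
    have near_inf: "J (s k) < m + e\<^sup>2 / 4" if "k \<ge> n" for k
    proof -
      have "inverse (real (Suc k)) \<le> inverse (real (Suc n))"
        using that by (auto intro!: le_imp_inverse_le)
      then have "m + inverse (real (Suc k)) < m + e\<^sup>2 / 4"
        using n by (intro add_strict_left_mono) (rule le_less_trans)
      then show ?thesis
        by (rule less_trans[OF s])
    qed
    have "dist (s i) (s j) < e" if "i \<ge> n" "j \<ge> n" for i j
    proof -
      have "(norm (s i - s j))\<^sup>2 < e\<^sup>2"
        using para[of "s i" "s j"] near_inf[OF that(1)] near_inf[OF that(2)] by argo
      then show ?thesis
        using \<open>e > 0\<close> by (simp add: dist_norm power2_less_imp_less)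
    qed
    then show "\<exists>M. \<forall>i\<ge>M. \<forall>j\<ge>M. dist (s i) (s j) < e"
      by blast
  qed
  then obtain v where v: "s \<longlonglongrightarrow> v"
    using Cauchy_convergent convergent_def by blast
  have "(\<lambda>n. J (s n)) \<longlonglongrightarrow> J v"
    unfolding J_def by (intro tendsto_intros v \<phi>.tendsto)
  moreover have "(\<lambda>n. m + inverse (real (Suc n))) \<longlonglongrightarrow> m + 0"
    by (intro tendsto_intros LIMSEQ_inverse_real_of_nat)
  ultimately have "J v \<le> m"
    using LIMSEQ_le[of "\<lambda>n. J (s n)" "J v" "\<lambda>n. m + inverse (real (Suc n))" "m + 0"] s
    by (force intro: less_imp_le)
  then have min: "J v \<le> J w" for w
    using m_le[of w] by linarith
  have "\<phi> h = inner h v" for h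
  proof (cases "h = 0")
    case False
    \<comment> \<open>\<open>t\<close> minimizes the quadratic polynomial \<open>J (v + t h)\<close>, whose linear coefficient is \<open>2 c\<close>.\<close>
    define c where "c = inner h v - \<phi> h"
    define t where "t = - c / (norm h)\<^sup>2"
    have "J (v + t *\<^sub>R h) = J v + (2 * t * c + t\<^sup>2 * (norm h)\<^sup>2)"
      unfolding J_def c_def power2_norm_eq_inner
      by (simp add: \<phi>.add \<phi>.scaleR inner_add_left inner_add_right inner_commute
          power2_eq_square algebra_simps)
    also have "2 * t * c + t\<^sup>2 * (norm h)\<^sup>2 = - c\<^sup>2 / (norm h)\<^sup>2"
      using False by (simp add: t_def field_simps power2_eq_square)
    finally have "c\<^sup>2 / (norm h)\<^sup>2 \<le> 0"
      using min[of "v + t *\<^sub>R h"] by simp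
    then have "c = 0"
      using False by (simp add: divide_le_0_iff)
    then show ?thesis
      by (simp add: c_def)
  qed simp
  then show ?thesis by blast
qed

lemma bounded_clinear_imp_bounded_linear: "bounded_clinear T \<Longrightarrow> bounded_linear T"
  and bounded_clinear_scaleC: "bounded_clinear T \<Longrightarrow> T (c *\<^sub>C x) = c *\<^sub>C T x"
  by (simp_all add: bounded_clinear_def)

text \<open>The Riesz representative of the real functional \<open>\<lambda>x. inner (T x) y\<close> also represents the complex
  one, because \<open>T\<close> commutes with multiplication by \<open>-\<i>\<close> and the imaginary part of a complex number is
  the real part of its product with \<open>-\<i>\<close>.\<close>
lemma cadjoint_exists:
  assumes "bounded_clinear T"
  shows "\<exists>T'. \<forall>x y. cinner (T x) y = cinner x (T' y)"
proof -
  have "\<exists>v. \<forall>x. cinner (T x) y = cinner x v" for y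
  proof -
    have "bounded_linear (\<lambda>x. inner (T x) y)"
      using bounded_clinear_imp_bounded_linear[OF assms]
      by (rule bounded_linear_compose[OF bounded_linear_inner_left])
    then obtain v where v: "\<And>x. inner (T x) y = inner x v"
      using riesz_representation by blast
    have "cinner (T x) y = cinner x v" for x
    proof (rule complex_eqI)
      show "Re (cinner (T x) y) = Re (cinner x v)"
        by (simp add: Re_cinner v)
      \<comment> \<open>The imaginary part is the real part at the vector \<open>-\<i> x\<close>.\<close>
      have "Im c = Re (- \<i> * c)" for c by simp
      then show "Im (cinner (T x) y) = Im (cinner x v)"
        using v[of "(- \<i>) *\<^sub>C x"] assms
        by (metis Re_cinner bounded_clinear_scaleC cinner_scaleC_left)
    qed
    then show ?thesis by blast
  qed
  then show ?thesis by metis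
qed

lemma cinner_cadjoint:
  assumes "bounded_clinear T"
  shows "cinner (T x) y = cinner x (cadjoint T y)"
proof -
  have "\<exists>!T'. \<forall>x y. cinner (T x) y = cinner x (T' y)"
    using cadjoint_exists[OF assms] by (metis (no_types) cinner_eq_imp_eq ext)
  from theI'[OF this] show ?thesis
    unfolding cadjoint_def by blast
qed

lemma cinner_cadjoint_left:
  assumes "bounded_clinear T"
  shows "cinner (cadjoint T y) x = cinner y (T x)"
  using cinner_cadjoint[OF assms] cinner_commute by metis

lemma cinner_cadjoint_funpow_left:
  fixes T :: "'a :: complex_hilbert \<Rightarrow> 'a"
  assumes "bounded_clinear T"
  shows "cinner ((cadjoint T ^^ n) y) x = cinner y ((T ^^ n) x)"
proof (induction n arbitrary: y)
  case (Suc n)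
  have "cinner ((cadjoint T ^^ Suc n) y) x = cinner ((cadjoint T ^^ n) (cadjoint T y)) x"
    by (simp only: funpow_Suc_right comp_apply)
  then show ?case
    by (simp add: Suc cinner_cadjoint_left[OF assms])
qed simp

lemma cadjoint_add:
  assumes "bounded_clinear T"
  shows "cadjoint T (x + y) = cadjoint T x + cadjoint T y"
  by (rule cinner_eq_imp_eq)
    (simp add: cinner_add_right cinner_cadjoint[OF assms, symmetric])

lemma cadjoint_scaleC:
  assumes "bounded_clinear T"
  shows "cadjoint T (c *\<^sub>C x) = c *\<^sub>C cadjoint T x"
  by (rule cinner_eq_imp_eq)
    (simp add: cinner_scaleC_right cinner_cadjoint[OF assms, symmetric])

lemma bounded_clinear_compose:
  assumes "bounded_clinear S" "bounded_clinear T"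
  shows "bounded_clinear (\<lambda>x. S (T x))"
  using assms unfolding bounded_clinear_def by (auto intro: bounded_linear_compose)

lemma bounded_clinear_funpow:
  fixes T :: "'a :: complex_hilbert \<Rightarrow> 'a"
  assumes "bounded_clinear T"
  shows "bounded_clinear (T ^^ n)"
proof (induction n)
  case 0
  then show ?case by (simp add: bounded_clinear_def bounded_linear_ident eq_id_iff[THEN iffD1] id_def)
next
  case (Suc n)
  then show ?case
    using bounded_clinear_compose[OF assms Suc] by (simp add: o_def)
qed

section \<open>Schur functions have contractive Toeplitz matrices\<close>
definition circle_point :: "real \<Rightarrow> nat \<Rightarrow> nat \<Rightarrow> complex" where
  "circle_point r M j = complex_of_real r * cis (2 * pi * real j / real M)"

text \<open>The mean over the \<open>M\<close> equidistant points of the circle of radius \<open>r\<close> replaces the integral mean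
  over the circle: for polynomials of degree below \<open>M\<close> the two agree, and for power series they agree in
  the limit of large \<open>M\<close>, so that only finite sums have to be manipulated.\<close>
definition circle_mean :: "real \<Rightarrow> nat \<Rightarrow> (complex \<Rightarrow> complex) \<Rightarrow> complex" where
  "circle_mean r M f = (\<Sum>j<M. f (circle_point r M j)) / of_nat M"

lemma norm_circle_point: "r \<ge> 0 \<Longrightarrow> cmod (circle_point r M j) = r"
  by (simp add: circle_point_def norm_mult)

lemma circle_mean_sum:
  "circle_mean r M (\<lambda>z. \<Sum>i\<in>I. f i z) = (\<Sum>i\<in>I. circle_mean r M (f i))"
  unfolding circle_mean_def by (subst sum.swap) (simp add: sum_divide_distrib)

lemma circle_mean_add: "circle_mean r M (\<lambda>z. f z + g z) = circle_mean r M f + circle_mean r M g"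
  by (simp add: circle_mean_def sum.distrib add_divide_distrib)

lemma circle_mean_cmult: "circle_mean r M (\<lambda>z. c * f z) = c * circle_mean r M f"
  by (simp add: circle_mean_def sum_distrib_left)

lemma circle_mean_mono:
  assumes "r \<ge> 0" "\<And>z. cmod z = r \<Longrightarrow> Re (f z) \<le> Re (g z)"
  shows "Re (circle_mean r M f) \<le> Re (circle_mean r M g)"
  unfolding circle_mean_def
  using assms by (auto simp: norm_circle_point Re_divide_of_nat intro!: divide_right_mono sum_mono)

text \<open>On the points of the mean, \<open>z ^ p * cnj z ^ q\<close> is \<open>r ^ (p + q)\<close> times the powers of the \<open>M\<close>-th
  root of unity \<open>exp (2 \<pi> \<i> (p - q) / M)\<close>; they sum to \<open>0\<close> unless that root is \<open>1\<close>.\<close>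
lemma circle_mean_monomial:
  assumes "M > 0"
  shows "circle_mean r M (\<lambda>z. z ^ p * cnj z ^ q) =
    (if p mod M = q mod M then complex_of_real (r ^ (p + q)) else 0)"
proof -
  define c where "c = cis (2 * pi * (real p - real q) / real M)"
  have pt: "circle_point r M j ^ p * cnj (circle_point r M j) ^ q = complex_of_real (r ^ (p + q)) * c ^ j" for j
  proof -
    have "cis (2 * pi * real j / real M) ^ p * cnj (cis (2 * pi * real j / real M)) ^ q = c ^ j"
      unfolding c_def cis_cnj
      by (simp add: Complex.DeMoivre cis_mult field_simps diff_divide_distrib add_divide_distrib)
    then show ?thesis
      by (simp add: circle_point_def power_mult_distrib power_add algebra_simps)
  qed
  have c1: "c = 1 \<longleftrightarrow> p mod M = q mod M"
  proof -
    have "c = 1 \<longleftrightarrow> (\<exists>k::int. 2 * pi * (real p - real q) / real M = 2 * pi * of_int k)"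
    proof -
      have "cis t = 1 \<longleftrightarrow> cos t = 1" for t
        by (auto simp: complex_eq_iff intro: cos_one_sin_zero)
      then show ?thesis
        by (simp only: c_def cos_one_2pi_int) (simp add: mult_ac)
    qed
    also have "\<dots> \<longleftrightarrow> (\<exists>k::int. real_of_int (int p - int q) = real_of_int (int M * k))"
    proof -
      have "2 * pi * a / real M = 2 * pi * b \<longleftrightarrow> a = real M * b" for a b
        using assms by (simp only: times_divide_eq_right[symmetric] mult_cancel_left) (simp add: divide_eq_eq mult.commute)
      then show ?thesis
        by simp
    qed
    also have "\<dots> \<longleftrightarrow> int M dvd int p - int q"
      unfolding of_int_eq_iff dvd_def ..
    also have "\<dots> \<longleftrightarrow> p mod M = q mod M"
      by (metis mod_eq_dvd_iff of_nat_eq_iff zmod_int)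
    finally show ?thesis .
  qed
  have "c ^ M = 1"
  proof -
    have "c ^ M = cis (2 * pi * of_int (int p - int q))"
      using assms by (simp add: c_def Complex.DeMoivre)
    also have "\<dots> = 1"
      by (rule cis_multiple_2pi) simp
    finally show ?thesis .
  qed
  then have "c \<noteq> 1 \<Longrightarrow> (\<Sum>j<M. c ^ j) = 0"
    by (simp add: geometric_sum)
  moreover have "circle_mean r M (\<lambda>z. z ^ p * cnj z ^ q) =
      complex_of_real (r ^ (p + q)) * (\<Sum>j<M. c ^ j) / of_nat M"
    unfolding circle_mean_def pt by (simp add: sum_distrib_left)
  ultimately show ?thesis
    using assms c1 by auto
qed

text \<open>Parseval's identity for polynomials: since all exponents are below \<open>M\<close>, the aliasing in the discrete
  orthogonality relations cannot occur.\<close>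
lemma circle_mean_norm_poly:
  fixes u :: "nat \<Rightarrow> 'a :: complex_hilbert"
  assumes "N < M"
  shows "circle_mean r M (\<lambda>z. complex_of_real ((norm (\<Sum>k\<le>N. (z ^ k) *\<^sub>C u k))\<^sup>2)) =
    complex_of_real (\<Sum>k\<le>N. r ^ (2 * k) * (norm (u k))\<^sup>2)"
proof -
  have "complex_of_real ((norm (\<Sum>k\<le>N. (z ^ k) *\<^sub>C u k))\<^sup>2) =
      (\<Sum>k\<le>N. \<Sum>l\<le>N. cinner (u k) (u l) * (z ^ k * cnj z ^ l))" for z
    unfolding cinner_self[symmetric] cinner_sum_left
    unfolding cinner_sum_right by (simp add: cinner_scaleC_left cinner_scaleC_right mult_ac)
  then have "circle_mean r M (\<lambda>z. complex_of_real ((norm (\<Sum>k\<le>N. (z ^ k) *\<^sub>C u k))\<^sup>2)) =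
      (\<Sum>k\<le>N. \<Sum>l\<le>N. cinner (u k) (u l) *
        (if k mod M = l mod M then complex_of_real (r ^ (k + l)) else 0))"
    using assms by (simp add: circle_mean_sum circle_mean_cmult circle_mean_monomial)
  also have "\<dots> = (\<Sum>k\<le>N. \<Sum>l\<le>N. if l = k then cinner (u k) (u k) * complex_of_real (r ^ (2 * k)) else 0)"
    using assms by (intro sum.cong refl) (auto simp: mult_2)
  also have "\<dots> = complex_of_real (\<Sum>k\<le>N. r ^ (2 * k) * (norm (u k))\<^sup>2)"
    by (simp add: cinner_self mult.commute)
  finally show ?thesis .
qed

text \<open>The mean picks out the coefficients \<open>a m\<close> with \<open>k + m\<close> congruent to \<open>n\<close> modulo \<open>M\<close>. As \<open>M\<close> grows,
  every such \<open>m\<close> other than \<open>n - k\<close> escapes to infinity, and dominated convergence for series (Tannery)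
  lets only the term with \<open>m = n - k\<close> survive.\<close>
lemma circle_mean_power_series_tendsto:
  assumes r: "0 < r" "r < 1"
    and f: "\<And>z. cmod z < 1 \<Longrightarrow> (\<lambda>m. a m * z ^ m) sums f z"
  shows "(\<lambda>M. circle_mean r (Suc M) (\<lambda>z. z ^ k * cnj z ^ n * f z)) \<longlonglongrightarrow>
    (if k \<le> n then a (n - k) * complex_of_real (r ^ (2 * n)) else 0)"
proof -
  define t where "t m M = a m * complex_of_real (r ^ (k + m + n)) *
    (if (k + m) mod Suc M = n mod Suc M then 1 else 0)" for m M
  define t0 where "t0 m = a m * complex_of_real (r ^ (k + m + n)) * (if k + m = n then 1 else 0)" for m
  have summ: "summable (\<lambda>m. norm (a m * complex_of_real r ^ m))"
  proof (rule powser_insidea)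
    \<comment> \<open>\<open>(1 + r) / 2\<close> lies strictly between \<open>r\<close> and the radius \<open>1\<close>.\<close>
    show "summable (\<lambda>m. a m * complex_of_real ((1 + r) / 2) ^ m)"
      using f[of "complex_of_real ((1 + r) / 2)"] r
      by (simp only: norm_of_real sums_summable) (simp add: sums_iff)
    show "norm (complex_of_real r) < norm (complex_of_real ((1 + r) / 2))"
      unfolding norm_of_real using r by simp
  qed
  have mean: "circle_mean r (Suc M) (\<lambda>z. z ^ k * cnj z ^ n * f z) = (\<Sum>m. t m M)" for M
  proof -
    have "(\<lambda>m. circle_mean r (Suc M) (\<lambda>z. z ^ k * cnj z ^ n * (a m * z ^ m))) sums
        circle_mean r (Suc M) (\<lambda>z. z ^ k * cnj z ^ n * f z)"
      unfolding circle_mean_def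
      using r by (intro sums_divide sums_sum sums_mult f) (simp add: norm_circle_point)
    moreover have "circle_mean r (Suc M) (\<lambda>z. z ^ k * cnj z ^ n * (a m * z ^ m)) = t m M" for m
    proof -
      have "circle_mean r (Suc M) (\<lambda>z. z ^ k * cnj z ^ n * (a m * z ^ m)) =
          circle_mean r (Suc M) (\<lambda>z. a m * (z ^ (k + m) * cnj z ^ n))"
        by (simp add: power_add mult_ac)
      then show ?thesis
        by (simp add: circle_mean_cmult circle_mean_monomial t_def)
    qed
    ultimately show ?thesis
      by (simp add: sums_iff)
  qed
  have "(\<lambda>M. \<Sum>m. t m M) \<longlonglongrightarrow> (\<Sum>m. t0 m)"
  proof (rule conjunct2[OF conjunct2[OF tannerys_theorem]])
    show "(\<lambda>M. t m M) \<longlonglongrightarrow> t0 m" for m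
    proof (rule tendsto_eventually)
      have "eventually (\<lambda>M. M \<ge> k + m + n) sequentially"
        by (rule eventually_ge_at_top)
      then show "\<forall>\<^sub>F M in sequentially. t m M = t0 m"
        by eventually_elim (simp add: t_def t0_def)
    qed
    show "\<forall>\<^sub>F (m, M) in sequentially \<times>\<^sub>F sequentially. norm (t m M) \<le> norm (a m * complex_of_real r ^ m)"
    proof (intro always_eventually allI, clarify)
      fix m M :: nat
      have "r ^ (k + m + n) \<le> r ^ m"
        using r by (intro power_decreasing) auto
      then show "norm (t m M) \<le> norm (a m * complex_of_real r ^ m)"
        using r by (auto simp: t_def norm_mult norm_power simp del: of_real_power intro!: mult_left_mono)
    qed
  qed (use summ in simp_all)
  moreover have "(\<Sum>m. t0 m) = (if k \<le> n then a (n - k) * complex_of_real (r ^ (2 * n)) else 0)"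
  proof (cases "k \<le> n")
    case True
    have "(\<Sum>m. t0 m) = (\<Sum>m\<in>{n - k}. t0 m)"
      by (rule suminf_finite) (use True in \<open>auto simp: t0_def\<close>)
    then show ?thesis
      using True by (simp add: t0_def mult_2)
  next
    case False
    then have "t0 m = 0" for m
      by (simp add: t0_def)
    then show ?thesis
      using False by simp
  qed
  ultimately show ?thesis
    by (simp add: mean)
qed

text \<open>Bounding the product \<open>norm (U z) * norm (W z)\<close> by half the sum of the squares, instead of using the
  Cauchy-Schwarz inequality for the means, keeps every bound linear in means of squared norms, which
  Parseval's identity evaluates.\<close>
lemma schur_bilinear_bound:
  fixes T :: "nat \<Rightarrow> 'u :: complex_hilbert \<Rightarrow> 'y :: complex_hilbert"
  assumes \<Phi>: "\<Phi> \<in> schur_class"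
    and series: "\<And>z u w. cmod z < 1 \<Longrightarrow> (\<lambda>m. cinner (T m u) w * z ^ m) sums cinner (\<Phi> z u) w"
  shows "Re (\<Sum>n\<le>N. cinner (\<Sum>k\<le>n. T (n - k) (u k)) (w n)) \<le>
    ((\<Sum>k\<le>N. (norm (u k))\<^sup>2) + (\<Sum>n\<le>N. (norm (w n))\<^sup>2)) / 2"
proof -
  have lin: "bounded_clinear (\<Phi> z)" and bound: "onorm (\<Phi> z) \<le> 1" if "cmod z < 1" for z
    using \<Phi> that by (auto simp: schur_class_def operator_holomorphic_on_def)
  have scaled: "Re (\<Sum>n\<le>N. complex_of_real (r ^ (2 * n)) * cinner (\<Sum>k\<le>n. T (n - k) (u k)) (w n)) \<le>
      ((\<Sum>k\<le>N. (norm (u k))\<^sup>2) + (\<Sum>n\<le>N. (norm (w n))\<^sup>2)) / 2" if r: "0 < r" "r < 1" for r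
  proof -
    define U W where "U z = (\<Sum>k\<le>N. (z ^ k) *\<^sub>C u k)" and "W z = (\<Sum>n\<le>N. (z ^ n) *\<^sub>C w n)" for z
    define g where "g z = (\<Sum>k\<le>N. \<Sum>n\<le>N. z ^ k * cnj z ^ n * cinner (\<Phi> z (u k)) (w n))" for z
    have g_eq: "g z = cinner (\<Phi> z (U z)) (W z)" if "cmod z < 1" for z
    proof -
      have "\<Phi> z (U z) = (\<Sum>k\<le>N. (z ^ k) *\<^sub>C \<Phi> z (u k))"
        using bounded_linear.linear[OF bounded_clinear_imp_bounded_linear[OF lin[OF that]]]
        by (simp add: U_def linear_sum bounded_clinear_scaleC[OF lin[OF that]])
      then show ?thesis
        unfolding g_def W_def by (simp only: cinner_sum_left)
          (simp add: cinner_sum_right cinner_scaleC_left cinner_scaleC_right sum_distrib_left mult_ac)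
    qed
    have g_le: "Re (g z) \<le> ((norm (U z))\<^sup>2 + (norm (W z))\<^sup>2) / 2" if "cmod z < 1" for z
    proof -
      have "norm (\<Phi> z (U z)) \<le> onorm (\<Phi> z) * norm (U z)"
        by (rule onorm[OF bounded_clinear_imp_bounded_linear[OF lin[OF that]]])
      also have "\<dots> \<le> norm (U z)"
        using mult_right_mono[OF bound[OF that] norm_ge_zero, of "U z"] by simp
      finally have contr: "norm (\<Phi> z (U z)) \<le> norm (U z)" .
      have "Re (g z) \<le> norm (\<Phi> z (U z)) * norm (W z)"
        unfolding g_eq[OF that] Re_cinner by (rule norm_cauchy_schwarz)
      also have "\<dots> \<le> norm (U z) * norm (W z)"
        by (intro mult_right_mono contr norm_ge_zero)
      also have "\<dots> \<le> ((norm (U z))\<^sup>2 + (norm (W z))\<^sup>2) / 2"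
        using sum_squares_bound[of "norm (U z)" "norm (W z)"] by simp
      finally show ?thesis .
    qed
    have "Re (circle_mean r (Suc M) g) \<le> ((\<Sum>k\<le>N. (norm (u k))\<^sup>2) + (\<Sum>n\<le>N. (norm (w n))\<^sup>2)) / 2" if "M \<ge> N" for M
    proof -
      have "Re (circle_mean r (Suc M) g) \<le> Re (circle_mean r (Suc M)
          (\<lambda>z. (1/2) * (complex_of_real ((norm (U z))\<^sup>2) + complex_of_real ((norm (W z))\<^sup>2))))"
        using r g_le by (intro circle_mean_mono) auto
      also have "\<dots> = ((\<Sum>k\<le>N. r ^ (2 * k) * (norm (u k))\<^sup>2) + (\<Sum>n\<le>N. r ^ (2 * n) * (norm (w n))\<^sup>2)) / 2"
        using that unfolding circle_mean_cmult circle_mean_add U_def W_def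
        by (simp add: circle_mean_norm_poly del: of_real_power of_real_sum of_real_mult)
      also have "\<dots> \<le> ((\<Sum>k\<le>N. (norm (u k))\<^sup>2) + (\<Sum>n\<le>N. (norm (w n))\<^sup>2)) / 2"
        using r by (intro divide_right_mono add_mono sum_mono mult_left_le_one_le) (auto intro: power_le_one)
      finally show ?thesis .
    qed
    moreover have "(\<lambda>M. circle_mean r (Suc M) g) \<longlonglongrightarrow>
        (\<Sum>k\<le>N. \<Sum>n\<le>N. if k \<le> n then cinner (T (n - k) (u k)) (w n) * complex_of_real (r ^ (2 * n)) else 0)"
      unfolding g_def circle_mean_sum
      by (intro tendsto_sum circle_mean_power_series_tendsto r series)
    ultimately have "Re (\<Sum>k\<le>N. \<Sum>n\<le>N. if k \<le> n then cinner (T (n - k) (u k)) (w n) * complex_of_real (r ^ (2 * n)) else 0)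
        \<le> ((\<Sum>k\<le>N. (norm (u k))\<^sup>2) + (\<Sum>n\<le>N. (norm (w n))\<^sup>2)) / 2"
      by (intro tendsto_upperbound[OF tendsto_Re]) (auto intro!: eventually_sequentiallyI[of N])
    also have "(\<Sum>k\<le>N. \<Sum>n\<le>N. if k \<le> n then cinner (T (n - k) (u k)) (w n) * complex_of_real (r ^ (2 * n)) else 0) =
        (\<Sum>n\<le>N. complex_of_real (r ^ (2 * n)) * cinner (\<Sum>k\<le>n. T (n - k) (u k)) (w n))"
    proof (subst sum.swap, intro sum.cong refl)
      fix n assume "n \<in> {..N}"
      then have "{k \<in> {..N}. k \<le> n} = {..n}"
        by auto
      then show "(\<Sum>k\<le>N. if k \<le> n then cinner (T (n - k) (u k)) (w n) * complex_of_real (r ^ (2 * n)) else 0) =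
          complex_of_real (r ^ (2 * n)) * cinner (\<Sum>k\<le>n. T (n - k) (u k)) (w n)"
        by (simp add: sum.inter_filter[symmetric] cinner_sum_left sum_distrib_left mult.commute)
    qed
    finally show ?thesis .
  qed
  have "((\<lambda>r. Re (\<Sum>n\<le>N. complex_of_real (r ^ (2 * n)) * cinner (\<Sum>k\<le>n. T (n - k) (u k)) (w n))) \<longlongrightarrow>
      Re (\<Sum>n\<le>N. complex_of_real (1 ^ (2 * n)) * cinner (\<Sum>k\<le>n. T (n - k) (u k)) (w n))) (at_left (1::real))"
    by (intro tendsto_intros)
  moreover have "eventually (\<lambda>r. Re (\<Sum>n\<le>N. complex_of_real (r ^ (2 * n)) * cinner (\<Sum>k\<le>n. T (n - k) (u k)) (w n)) \<le>
      ((\<Sum>k\<le>N. (norm (u k))\<^sup>2) + (\<Sum>n\<le>N. (norm (w n))\<^sup>2)) / 2) (at_left (1::real))"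
    using eventually_at_left_real[OF zero_less_one] by (rule eventually_mono) (use scaled in auto)
  ultimately have "Re (\<Sum>n\<le>N. complex_of_real (1 ^ (2 * n)) * cinner (\<Sum>k\<le>n. T (n - k) (u k)) (w n)) \<le>
      ((\<Sum>k\<le>N. (norm (u k))\<^sup>2) + (\<Sum>n\<le>N. (norm (w n))\<^sup>2)) / 2"
    by (rule tendsto_upperbound) simp
  then show ?thesis
    by simp
qed

text \<open>Testing the bilinear bound against the output \<open>w = y\<close> gives
  \<open>\<parallel>y\<parallel>\<^sup>2 \<le> (\<parallel>u\<parallel>\<^sup>2 + \<parallel>y\<parallel>\<^sup>2) / 2\<close>.\<close>
lemma schur_toeplitz_contraction_nat:
  fixes T :: "nat \<Rightarrow> 'u :: complex_hilbert \<Rightarrow> 'y :: complex_hilbert"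
  assumes "\<Phi> \<in> schur_class"
    and "\<And>z u w. cmod z < 1 \<Longrightarrow> (\<lambda>m. cinner (T m u) w * z ^ m) sums cinner (\<Phi> z u) w"
  shows "(\<Sum>n\<le>N. (norm (\<Sum>k\<le>n. T (n - k) (u k)))\<^sup>2) \<le> (\<Sum>k\<le>N. (norm (u k))\<^sup>2)"
proof -
  define y where "y n = (\<Sum>k\<le>n. T (n - k) (u k))" for n
  have "Re (\<Sum>n\<le>N. cinner (y n) (y n)) \<le> ((\<Sum>k\<le>N. (norm (u k))\<^sup>2) + (\<Sum>n\<le>N. (norm (y n))\<^sup>2)) / 2"
    using schur_bilinear_bound[OF assms, where N = N and u = u and w = y] unfolding y_def by simp
  then show ?thesis
    unfolding y_def by (simp add: cinner_self)
qed

section \<open>Markov parameters as Taylor coefficients\<close>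
lemma bounded_linear_scaleC: "bounded_linear (\<lambda>x. c *\<^sub>C (x :: 'a :: complex_hilbert))"
proof (rule bounded_linear_intro[where K = "cmod c"])
  show "c *\<^sub>C r *\<^sub>R x = r *\<^sub>R c *\<^sub>C x" for r and x :: 'a
    by (simp add: scaleR_scaleC scaleC_scaleC mult.commute)
qed (simp_all add: scaleC_add_right norm_scaleC mult.commute)

lemma norm_funpow_le:
  fixes A :: "'x :: real_normed_vector \<Rightarrow> 'x"
  assumes "bounded_linear A"
  shows "norm ((A ^^ n) b) \<le> onorm A ^ n * norm b"
proof (induction n)
  case (Suc n)
  have "norm (A ((A ^^ n) b)) \<le> onorm A * norm ((A ^^ n) b)"
    by (rule onorm[OF assms])
  also have "\<dots> \<le> onorm A * (onorm A ^ n * norm b)"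
    by (rule mult_left_mono[OF Suc onorm_pos_le[OF assms]])
  finally show ?case
    by (simp add: mult.assoc)
qed simp

text \<open>The sum \<open>s\<close> of the series satisfies \<open>s - z A s = b\<close> by shifting the index; as \<open>I - z A\<close> is
  injective for \<open>\<bar>z\<bar> \<parallel>A\<parallel> < 1\<close>, the solution \<open>s\<close> is the value of \<open>inv\<close>.\<close>
lemma neumann_series:
  fixes A :: "'x :: complex_hilbert \<Rightarrow> 'x"
  assumes A: "bounded_clinear A" and z: "cmod z * onorm A < 1"
  shows "(\<lambda>n. (z ^ n) *\<^sub>C (A ^^ n) b) sums inv (\<lambda>x. x - z *\<^sub>C A x) b"
proof -
  note lin = bounded_clinear_imp_bounded_linear[OF A]
  define f where "f n = (z ^ n) *\<^sub>C (A ^^ n) b" for n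
  have "norm (f n) \<le> norm b * (cmod z * onorm A) ^ n" for n
    using mult_left_mono[OF norm_funpow_le[OF lin, of n b], of "cmod z ^ n"]
    by (simp add: f_def norm_scaleC norm_power power_mult_distrib mult_ac)
  moreover have "summable (\<lambda>n. norm b * (cmod z * onorm A) ^ n)"
    using z onorm_pos_le[OF lin] by (intro summable_mult summable_geometric) simp
  ultimately have "summable f"
    by (rule summable_comparison_test'[rotated])
  then obtain s where s: "f sums s"
    by blast
  have "bounded_linear (\<lambda>x. z *\<^sub>C A x)"
    by (rule bounded_linear_compose[OF bounded_linear_scaleC lin])
  then have "(\<lambda>n. z *\<^sub>C A (f n)) sums (z *\<^sub>C A s)"
    using s by (rule bounded_linear.sums)
  then have "(\<lambda>n. f (Suc n)) sums (z *\<^sub>C A s)"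
    by (simp add: f_def bounded_clinear_scaleC[OF A] scaleC_scaleC)
  moreover have "(\<lambda>n. f (Suc n)) sums (s - b)"
    using s sums_Suc_iff[of f "s - b"] by (simp add: f_def)
  ultimately have fix_pt: "s - z *\<^sub>C A s = b"
    using sums_unique2 by fastforce
  have "inj (\<lambda>x. x - z *\<^sub>C A x)"
  proof (rule injI)
    fix x y
    assume "x - z *\<^sub>C A x = y - z *\<^sub>C A y"
    then have "x - y = z *\<^sub>C A (x - y)"
      by (simp add: linear_diff[OF bounded_linear.linear[OF lin]]
          linear_diff[OF bounded_linear.linear[OF bounded_linear_scaleC]] algebra_simps)
    then have "norm (x - y) = cmod z * norm (A (x - y))"
      by (metis norm_scaleC)
    also have "\<dots> \<le> (cmod z * onorm A) * norm (x - y)"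
      using mult_left_mono[OF onorm[OF lin], of "cmod z"] by (simp add: mult.assoc)
    finally have "(1 - cmod z * onorm A) * norm (x - y) \<le> 0"
      by (simp add: algebra_simps)
    then show "x = y"
      using z by (simp add: mult_le_0_iff)
  qed
  then have "inv (\<lambda>x. x - z *\<^sub>C A x) b = s"
    by (rule inv_f_eq) (rule fix_pt)
  then show ?thesis
    using s by (simp add: f_def[abs_def])
qed

lemma transfer_function_series:
  assumes A: "bounded_clinear A" and C: "bounded_clinear C" and z: "cmod z * onorm A < 1"
  shows "(\<lambda>m. cinner (markov A B C D m u) w * z ^ m) sums cinner (transfer_function A B C D z u) w"
proof -
  define s where "s = inv (\<lambda>x. x - z *\<^sub>C A x) (B u)"
  have "bounded_linear (\<lambda>x. cinner (C x) w)"
    using bounded_linear_compose[OF bounded_linear_cinner_left bounded_clinear_imp_bounded_linear[OF C]] .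
  then have "(\<lambda>n. cinner (C ((z ^ n) *\<^sub>C (A ^^ n) (B u))) w) sums cinner (C s) w"
    using neumann_series[OF A z, of "B u"] unfolding s_def by (rule bounded_linear.sums)
  from sums_mult[OF this, of z]
  have "(\<lambda>n. cinner (markov A B C D (Suc n) u) w * z ^ Suc n) sums (z * cinner (C s) w)"
    by (simp add: markov_def bounded_clinear_scaleC[OF C] cinner_scaleC_left mult_ac)
  then show ?thesis
    by (subst (asm) sums_Suc_iff)
      (simp add: transfer_function_def s_def[symmetric] cinner_add_left cinner_scaleC_left
        markov_def add.commute)
qed

lemma operator_holomorphic_imp_holomorphic_cinner:
  assumes F: "operator_holomorphic_on F S" and "open S"
  shows "(\<lambda>z. cinner (F z u) w) holomorphic_on S"
proof (rule holomorphic_onI)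
  fix z assume z: "z \<in> S"
  from F z obtain F' where F': "bounded_clinear F'"
    and lim: "((\<lambda>v. onorm (\<lambda>u. (1 / (v - z)) *\<^sub>C (F v u - F z u) - F' u)) \<longlongrightarrow> 0) (at z within S)"
    unfolding operator_holomorphic_on_def by blast
  define q where "q v u = (1 / (v - z)) *\<^sub>C (F v u - F z u) - F' u" for v u
  have lin: "bounded_linear (F v)" if "v \<in> S" for v
    using F that by (auto simp: operator_holomorphic_on_def bounded_clinear_imp_bounded_linear)
  have q: "bounded_linear (q v)" if "v \<in> S" for v
    unfolding q_def using lin[OF that] lin[OF z] bounded_clinear_imp_bounded_linear[OF F']
    by (intro bounded_linear_sub bounded_linear_compose[OF bounded_linear_scaleC])
  have "((\<lambda>v. (cinner (F v u) w - cinner (F z u) w) / (v - z) - cinner (F' u) w) \<longlongrightarrow> 0) (at z within S)"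
  proof (rule Lim_null_comparison)
    have "((\<lambda>v. onorm (q v) * norm u * norm w) \<longlongrightarrow> 0 * norm u * norm w) (at z within S)"
      using lim unfolding q_def by (intro tendsto_intros)
    then show "((\<lambda>v. onorm (q v) * norm u * norm w) \<longlongrightarrow> 0) (at z within S)"
      by simp
    have "norm ((cinner (F v u) w - cinner (F z u) w) / (v - z) - cinner (F' u) w)
        \<le> onorm (q v) * norm u * norm w" if "v \<in> S" for v
    proof -
      have "(cinner (F v u) w - cinner (F z u) w) / (v - z) - cinner (F' u) w = cinner (q v u) w"
        by (simp add: q_def cinner_diff_left cinner_scaleC_left diff_divide_distrib)
      also have "cmod \<dots> \<le> norm (q v u) * norm w"
        by (rule norm_cinner_le)
      also have "\<dots> \<le> onorm (q v) * norm u * norm w"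
        by (intro mult_right_mono onorm q that) simp
      finally show ?thesis .
    qed
    then show "\<forall>\<^sub>F v in at z within S. norm ((cinner (F v u) w - cinner (F z u) w) / (v - z)
        - cinner (F' u) w) \<le> onorm (q v) * norm u * norm w"
      by (auto simp: eventually_at_filter)
  qed
  then have "((\<lambda>z. cinner (F z u) w) has_field_derivative cinner (F' u) w) (at z within S)"
    unfolding has_field_derivative_iff by (simp add: Lim_null[symmetric])
  then show "(\<lambda>z. cinner (F z u) w) field_differentiable at z within S"
    using field_differentiable_def by blast
qed

text \<open>Near \<open>0\<close> the scalar function \<open>\<lambda>z. cinner (F z u) w\<close> agrees with the transfer function, whose
  power series has the Markov parameters as coefficients. A holomorphic function on the unit disc is the
  sum of its Taylor series on the whole disc, so the same expansion is valid up to radius \<open>1\<close>.\<close>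
lemma schur_continuation_series:
  assumes A: "bounded_clinear A" and C: "bounded_clinear C"
    and F: "F \<in> schur_class" and near_0: "\<forall>\<^sub>F z in nhds 0. F z = transfer_function A B C D z"
    and z: "cmod z < 1"
  shows "(\<lambda>m. cinner (markov A B C D m u) w * z ^ m) sums cinner (F z u) w"
proof -
  define P where "P = Abs_fps (\<lambda>m. cinner (markov A B C D m u) w)"
  \<comment> \<open>The Neumann series converges for \<open>\<bar>z\<bar> \<le> \<rho>\<close>; adding \<open>1\<close> covers the case \<open>A = 0\<close>.\<close>
  define \<rho> where "\<rho> = 1 / (onorm A + 1)"
  have K: "0 \<le> onorm A"
    by (rule onorm_pos_le[OF bounded_clinear_imp_bounded_linear[OF A]])
  then have \<rho>: "\<rho> > 0"
    by (simp add: \<rho>_def)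
  have small: "cmod v * onorm A < 1" if "cmod v \<le> \<rho>" for v
  proof -
    have "cmod v * onorm A \<le> \<rho> * onorm A"
      using that K by (rule mult_right_mono)
    also have "\<dots> < 1"
      using K by (simp add: \<rho>_def)
    finally show ?thesis .
  qed
  note series = transfer_function_series[OF A C small, of _ B D u w]
  have hol: "(\<lambda>z. cinner (F z u) w) holomorphic_on ball 0 1"
    using F by (intro operator_holomorphic_imp_holomorphic_cinner) (auto simp: schur_class_def)
  have "(\<lambda>z. cinner (F z u) w) has_fps_expansion P"
    unfolding has_fps_expansion_def
  proof
    have "ereal (norm (complex_of_real \<rho>)) \<le> fps_conv_radius P"
      unfolding fps_conv_radius_def P_def fps_nth_Abs_fps
      using series[of "complex_of_real \<rho>"] \<rho> by (intro conv_radius_geI) (auto simp: sums_iff)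
    then show "0 < fps_conv_radius P"
      using \<rho> by (auto intro: less_le_trans[of _ "ereal \<rho>"])
    have "\<forall>\<^sub>F v in nhds 0. v \<in> ball 0 \<rho>"
      using \<rho> by (intro eventually_nhds_in_open) auto
    with near_0 show "\<forall>\<^sub>F v in nhds 0. eval_fps P v = cinner (F v u) w"
    proof eventually_elim
      case (elim v)
      then show ?case
        using series[of v] by (simp add: eval_fps_def P_def sums_iff)
    qed
  qed
  from has_fps_expansion_imp_sums_complex[OF this, of 1 z] hol z show ?thesis
    by (simp add: P_def one_ereal_def)
qed

section \<open>Inputs from the infinite past and the states they reach\<close>
text \<open>In a Hilbert space, unconditional convergence of \<open>\<Sum> F (i - j) (u j)\<close> for a square-summable \<open>u\<close> cannot
  be had from absolute convergence. A bound on the squared norms of finite partial sums by those of a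
  convergent series still makes the net of partial sums Cauchy.\<close>
lemma summable_on_of_norm_sum_bound:
  fixes f :: "'i \<Rightarrow> 'a :: banach" and g :: "'i \<Rightarrow> real"
  assumes g: "g summable_on S"
    and bound: "\<And>J. finite J \<Longrightarrow> J \<subseteq> S \<Longrightarrow> (norm (\<Sum>j\<in>J. f j))\<^sup>2 \<le> (\<Sum>j\<in>J. g j)"
  shows "f summable_on S"
proof -
  obtain L where L: "(sum g \<longlongrightarrow> L) (finite_subsets_at_top S)"
    using g unfolding summable_on_def has_sum_def by blast
  have "\<exists>P. eventually P (finite_subsets_at_top S) \<and>
      (\<forall>F F'. P F \<and> P F' \<longrightarrow> dist (sum f F) (sum f F') < e)" if "e > 0" for e
  proof -
    have "eventually (\<lambda>F. dist (sum g F) L < e\<^sup>2 / 8) (finite_subsets_at_top S)"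
      by (rule tendstoD[OF L]) (use that in simp)
    from this[unfolded eventually_finite_subsets_at_top] obtain F0
      where F0: "finite F0" "F0 \<subseteq> S"
        and near_F0: "\<forall>F. finite F \<and> F0 \<subseteq> F \<and> F \<subseteq> S \<longrightarrow> dist (sum g F) L < e\<^sup>2 / 8"
      by (elim exE conjE)
    have near: "dist (sum g F) L < e\<^sup>2 / 8" if "finite F" "F0 \<subseteq> F" "F \<subseteq> S" for F
      by (intro near_F0[rule_format] conjI that)
    have close: "dist (sum f F) (sum f F0) < e / 2" if F: "finite F" "F0 \<subseteq> F" "F \<subseteq> S" for F
    proof -
      have "(norm (sum f F - sum f F0))\<^sup>2 = (norm (sum f (F - F0)))\<^sup>2"
        using F by (simp add: sum_diff)
      also have "\<dots> \<le> sum g (F - F0)"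
        using F by (intro bound) auto
      also have "\<dots> = sum g F - sum g F0"
        using F by (simp add: sum_diff)
      also have "\<dots> < (e / 2)\<^sup>2"
      proof -
        have "\<bar>sum g F - L\<bar> < e\<^sup>2 / 8" "\<bar>sum g F0 - L\<bar> < e\<^sup>2 / 8"
          using near[OF F] near[OF F0(1) order_refl F0(2)] by (simp_all only: dist_real_def)
        then have "sum g F - sum g F0 < e\<^sup>2 / 4"
          by linarith
        then show ?thesis
          by (simp add: power_divide)
      qed
      finally show ?thesis
        unfolding dist_norm by (rule power2_less_imp_less) (use \<open>e > 0\<close> in simp)
    qed
    show ?thesis
    proof (intro exI conjI allI impI)
      show "eventually (\<lambda>F. finite F \<and> F0 \<subseteq> F \<and> F \<subseteq> S) (finite_subsets_at_top S)"
        unfolding eventually_finite_subsets_at_top using F0 by blast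
      fix F F'
      assume "(finite F \<and> F0 \<subseteq> F \<and> F \<subseteq> S) \<and> finite F' \<and> F0 \<subseteq> F' \<and> F' \<subseteq> S"
      then show "dist (sum f F) (sum f F') < e"
        using close[of F] close[of F'] dist_triangle2[of "sum f F" "sum f F'" "sum f F0"] by linarith
    qed
  qed
  then have "cauchy_filter (filtermap (sum f) (finite_subsets_at_top S))"
    by (simp add: cauchy_filter_metric_filtermap)
  moreover have "complete (UNIV :: 'a set)"
    by (meson Cauchy_convergent UNIV_I complete_def convergent_def)
  ultimately obtain L' where "(sum f \<longlongrightarrow> L') (finite_subsets_at_top S)"
    using complete_uniform[where S = UNIV] by (force simp add: filterlim_def)
  then show ?thesis
    using summable_on_def has_sum_def by blast
qed

text \<open>The intervals \<open>{-K..i}\<close> exhaust \<open>{..i}\<close>, so they are a subnet of its finite subsets.\<close>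
lemma sum_int_interval_tendsto_infsum:
  fixes f :: "int \<Rightarrow> 'a :: {comm_monoid_add, t2_space}"
  assumes "f summable_on {..i}"
  shows "(\<lambda>K. \<Sum>j\<in>{- int K..i}. f j) \<longlonglongrightarrow> infsum f {..i}"
proof -
  have "filterlim (\<lambda>K. {- int K..i}) (finite_subsets_at_top {..i}) sequentially"
    unfolding filterlim_finite_subsets_at_top
  proof (intro allI impI)
    fix X assume X: "finite X \<and> X \<subseteq> {..i}"
    have "\<forall>\<^sub>F K in sequentially. - int K \<le> x" for x
      by (rule eventually_sequentiallyI[of "nat (- x)"]) auto
    then have "\<forall>\<^sub>F K in sequentially. \<forall>x\<in>X. - int K \<le> x"
      using X by (simp add: eventually_ball_finite)
    then show "\<forall>\<^sub>F K in sequentially. finite {- int K..i} \<and> X \<subseteq> {- int K..i} \<and> {- int K..i} \<subseteq> {..i}"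
      by eventually_elim (use X in auto)
  qed
  then show ?thesis
    by (rule filterlim_compose[OF infsum_tendsto[OF assms]])
qed

lemma l2_negI:
  assumes "\<And>n. n \<ge> 0 \<Longrightarrow> u n = 0" and "(\<lambda>n. (norm (u n))\<^sup>2) summable_on {..<0}"
  shows "u \<in> l2_neg"
  using assms by (auto simp: l2_neg_def)

lemma l2_neg_summable: "u \<in> l2_neg \<Longrightarrow> (\<lambda>n. (norm (u n))\<^sup>2) summable_on {..<0}"
  and l2_neg_nonneg_index: "u \<in> l2_neg \<Longrightarrow> n \<ge> 0 \<Longrightarrow> u n = 0"
  by (auto simp: l2_neg_def)

lemma l2_neg_add:
  assumes "u \<in> l2_neg" "v \<in> l2_neg"
  shows "(\<lambda>n. u n + v n) \<in> l2_neg"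
proof (rule l2_negI)
  have "(\<lambda>n. 2 * (norm (u n))\<^sup>2 + 2 * (norm (v n))\<^sup>2) summable_on {..<0}"
    using assms by (intro summable_on_add summable_on_cmult_right l2_neg_summable)
  then show "(\<lambda>n. (norm (u n + v n))\<^sup>2) summable_on {..<0}"
  proof (rule summable_on_comparison_test)
    fix n
    have "(norm (u n + v n))\<^sup>2 \<le> (norm (u n) + norm (v n))\<^sup>2"
      by (simp add: norm_triangle_ineq power_mono)
    also have "\<dots> \<le> 2 * (norm (u n))\<^sup>2 + 2 * (norm (v n))\<^sup>2"
      using sum_squares_bound[of "norm (u n)" "norm (v n)"] by (simp add: power2_sum)
    finally show "(norm (u n + v n))\<^sup>2 \<le> 2 * (norm (u n))\<^sup>2 + 2 * (norm (v n))\<^sup>2" .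
  qed simp
qed (use assms in \<open>simp add: l2_neg_nonneg_index\<close>)

lemma l2_neg_scaleC:
  assumes "u \<in> l2_neg"
  shows "(\<lambda>n. c *\<^sub>C u n) \<in> l2_neg"
proof (rule l2_negI)
  show "(\<lambda>n. (norm (c *\<^sub>C u n))\<^sup>2) summable_on {..<0}"
    unfolding norm_scaleC power_mult_distrib
    using assms by (intro summable_on_cmult_right l2_neg_summable)
qed (use assms in \<open>simp add: l2_neg_nonneg_index\<close>)

lemma l2_neg_diff:
  assumes "u \<in> l2_neg" "v \<in> l2_neg"
  shows "(\<lambda>n. u n - v n) \<in> l2_neg"
  using l2_neg_add[OF assms(1) l2_neg_scaleC[OF assms(2), of "-1"]] by (simp add: scaleC_minus_one)

lemma l2_neg_inner_summable:
  assumes "u \<in> l2_neg" "v \<in> l2_neg"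
  shows "(\<lambda>n. cinner (u n) (v n)) summable_on {..<0}"
proof (rule abs_summable_summable)
  have "(\<lambda>n. (norm (u n))\<^sup>2 + (norm (v n))\<^sup>2) summable_on {..<0}"
    using assms by (intro summable_on_add l2_neg_summable)
  then show "(\<lambda>n. norm (cinner (u n) (v n))) summable_on {..<0}"
  proof (rule summable_on_comparison_test)
    fix n
    have "2 * (norm (u n) * norm (v n)) \<le> (norm (u n))\<^sup>2 + (norm (v n))\<^sup>2"
      using sum_squares_bound[of "norm (u n)" "norm (v n)"] by simp
    then show "norm (cinner (u n) (v n)) \<le> (norm (u n))\<^sup>2 + (norm (v n))\<^sup>2"
      using norm_cinner_le[of "u n" "v n"] mult_nonneg_nonneg[OF norm_ge_zero norm_ge_zero, of "u n" "v n"]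
      by linarith
  qed simp
qed

lemma l2_neg_inner_diff_right:
  assumes "u \<in> l2_neg" "v \<in> l2_neg" "w \<in> l2_neg"
  shows "l2_neg_inner u (\<lambda>n. v n - w n) = l2_neg_inner u v - l2_neg_inner u w"
proof -
  have "(\<Sum>\<^sub>\<infinity>n\<in>{..<0}. cinner (u n) (v n) + - cinner (u n) (w n)) =
      (\<Sum>\<^sub>\<infinity>n\<in>{..<0}. cinner (u n) (v n)) + (\<Sum>\<^sub>\<infinity>n\<in>{..<0}. - cinner (u n) (w n))"
    using assms by (intro infsum_add summable_on_uminus[THEN iffD2] l2_neg_inner_summable)
  then show ?thesis
    by (simp add: l2_neg_inner_def cinner_diff_right infsum_uminus)
qed

lemma l2_neg_norm_squared: "(l2_neg_norm u)\<^sup>2 = (\<Sum>\<^sub>\<infinity>n\<in>{..<0}. (norm (u n))\<^sup>2)"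
  by (simp add: l2_neg_norm_def infsum_nonneg)

lemma lessThan_0_int: "{..<0::int} = {..-1}"
  by auto

text \<open>The properties of a minimal system with Schur class transfer function from which the results on
  storage functions follow. The Toeplitz inequality is the only trace of complex analysis in them.\<close>
locale contractive_observable_system =
  fixes A :: "'x :: complex_hilbert \<Rightarrow> 'x"
    and B :: "'u :: complex_hilbert \<Rightarrow> 'x"
    and C :: "'x \<Rightarrow> 'y :: complex_hilbert"
    and D :: "'u \<Rightarrow> 'y"
  assumes A: "bounded_clinear A" and B: "bounded_clinear B"
    and C: "bounded_clinear C" and D: "bounded_clinear D"
    and observable: "closure (cspan (\<Union>k. range (\<lambda>y. (cadjoint A ^^ k) (cadjoint C y)))) = UNIV"
    and toeplitz_contraction: "\<And>N u. (\<Sum>n\<le>N. (norm (\<Sum>k\<le>n. markov A B C D (n - k) (u k)))\<^sup>2)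
      \<le> (\<Sum>k\<le>N. (norm (u k))\<^sup>2)"
begin

abbreviation F :: "nat \<Rightarrow> 'u \<Rightarrow> 'y" where "F \<equiv> markov A B C D"

lemma bounded_clinear_markov: "bounded_clinear (F k)"
proof (cases k)
  case 0
  then show ?thesis using D by (simp add: markov_def[abs_def])
next
  case (Suc n)
  then show ?thesis
    using bounded_clinear_compose[OF C bounded_clinear_compose[OF bounded_clinear_funpow[OF A] B]]
    by (simp add: markov_def[abs_def])
qed

lemma markov_zero [simp]: "F k 0 = 0"
  by (rule linear_0[OF bounded_linear.linear[OF bounded_clinear_imp_bounded_linear[OF bounded_clinear_markov]]])

lemma toeplitz_contraction_int:
  "(\<Sum>i\<in>{a..b}. (norm (\<Sum>j\<in>{a..i}. F (nat (i - j)) (u j)))\<^sup>2) \<le> (\<Sum>j\<in>{a..b}. (norm (u j))\<^sup>2)"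
proof (cases "a \<le> b")
  case True
  have reindex: "(\<Sum>j\<in>{a..i}. g j) = (\<Sum>k\<le>nat (i - a). g (a + int k))" if "a \<le> i" for g :: "int \<Rightarrow> 'c :: comm_monoid_add" and i
    by (rule sum.reindex_bij_witness[of _ "\<lambda>k. a + int k" "\<lambda>j. nat (j - a)"]) (use that in auto)
  have inner_sum: "(\<Sum>j\<in>{a..a + int n}. F (nat (a + int n - j)) (u j)) = (\<Sum>k\<le>n. F (n - k) (u (a + int k)))" for n
    by (subst reindex) (auto simp: nat_diff_distrib' intro!: sum.cong arg_cong2[of _ _ _ _ F])
  show ?thesis
    unfolding reindex[OF True] inner_sum
    by (rule toeplitz_contraction)
next
  case False
  then show ?thesis by simp
qed

lemma truncated_response_contraction:
  assumes "finite I" "I \<subseteq> {..b}"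
  shows "(\<Sum>i\<in>I. (norm (\<Sum>j\<in>{a..i}. F (nat (i - j)) (u j)))\<^sup>2) \<le> (\<Sum>j\<in>{a..b}. (norm (u j))\<^sup>2)"
proof -
  have "(\<Sum>i\<in>I. (norm (\<Sum>j\<in>{a..i}. F (nat (i - j)) (u j)))\<^sup>2) =
      (\<Sum>i\<in>I \<inter> {a..b}. (norm (\<Sum>j\<in>{a..i}. F (nat (i - j)) (u j)))\<^sup>2)"
  proof (rule sum.mono_neutral_right[OF assms(1)])
    show "\<forall>i\<in>I - I \<inter> {a..b}. (norm (\<Sum>j\<in>{a..i}. F (nat (i - j)) (u j)))\<^sup>2 = 0"
    proof
      fix i assume "i \<in> I - I \<inter> {a..b}"
      then have "{a..i} = {}"
        using assms(2) by auto
      then show "(norm (\<Sum>j\<in>{a..i}. F (nat (i - j)) (u j)))\<^sup>2 = 0"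
        by (simp only: sum.empty) simp
    qed
  qed auto
  also have "\<dots> \<le> (\<Sum>i\<in>{a..b}. (norm (\<Sum>j\<in>{a..i}. F (nat (i - j)) (u j)))\<^sup>2)"
    by (intro sum_mono2) auto
  also note toeplitz_contraction_int
  finally show ?thesis .
qed

text \<open>A single row of the Toeplitz inequality, applied to the input that is set to zero outside \<open>J\<close>.\<close>
lemma norm_output_le:
  assumes "finite J" "J \<subseteq> {..i}"
  shows "(norm (\<Sum>j\<in>J. F (nat (i - j)) (u j)))\<^sup>2 \<le> (\<Sum>j\<in>J. (norm (u j))\<^sup>2)"
proof -
  \<comment> \<open>Inserting \<open>i\<close> makes the minimum meaningful for empty \<open>J\<close>.\<close>
  define a where "a = Min (insert i J)"
  define v where "v j = (if j \<in> J then u j else 0)" for j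
  have J: "J \<subseteq> {a..i}"
    using assms by (auto simp: a_def)
  have "(\<Sum>j\<in>{a..i}. F (nat (i - j)) (v j)) = (\<Sum>j\<in>J. F (nat (i - j)) (v j))"
    using J by (intro sum.mono_neutral_right) (auto simp: v_def)
  moreover have "(\<Sum>j\<in>{a..i}. (norm (v j))\<^sup>2) = (\<Sum>j\<in>J. (norm (v j))\<^sup>2)"
    using J by (intro sum.mono_neutral_right) (auto simp: v_def)
  ultimately show ?thesis
    using truncated_response_contraction[of "{i}" i v a] by (simp add: v_def)
qed

lemma output_summable:
  assumes "J \<subseteq> {..i}" "(\<lambda>j. (norm (u j))\<^sup>2) summable_on J"
  shows "(\<lambda>j. F (nat (i - j)) (u j)) summable_on J"
  by (rule summable_on_of_norm_sum_bound[OF assms(2)])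
    (use assms(1) in \<open>auto intro!: norm_output_le\<close>)

text \<open>The output at time \<open>i\<close> for an input on the whole past, as \<open>toeplitz_neg\<close> computes it, but defined also
  at nonnegative times, so that a past input can be continued by a future one.\<close>
definition response :: "(int \<Rightarrow> 'u) \<Rightarrow> int \<Rightarrow> 'y" where
  "response u i = (\<Sum>\<^sub>\<infinity>j\<in>{..i}. F (nat (i - j)) (u j))"

lemma toeplitz_neg_eq_response: "toeplitz_neg A B C D u i = (if i < 0 then response u i else 0)"
  by (simp add: toeplitz_neg_def response_def)

lemma truncated_response_tendsto:
  assumes "(\<lambda>j. (norm (u j))\<^sup>2) summable_on {..i}"
  shows "(\<lambda>K. \<Sum>j\<in>{- int K..i}. F (nat (i - j)) (u j)) \<longlonglongrightarrow> response u i"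
  unfolding response_def
  by (intro sum_int_interval_tendsto_infsum output_summable assms order_refl)

text \<open>The inequality holds for the inputs truncated to \<open>{-K..b}\<close>, and on the finitely many output times
  in \<open>I\<close> the truncated outputs converge.\<close>
lemma response_contraction:
  assumes u: "(\<lambda>j. (norm (u j))\<^sup>2) summable_on {..b}" and I: "finite I" "I \<subseteq> {..b}"
  shows "(\<Sum>i\<in>I. (norm (response u i))\<^sup>2) \<le> (\<Sum>\<^sub>\<infinity>j\<in>{..b}. (norm (u j))\<^sup>2)"
proof (rule LIMSEQ_le)
  show "(\<lambda>K. \<Sum>i\<in>I. (norm (\<Sum>j\<in>{- int K..i}. F (nat (i - j)) (u j)))\<^sup>2)
      \<longlonglongrightarrow> (\<Sum>i\<in>I. (norm (response u i))\<^sup>2)"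
    using I by (intro tendsto_intros truncated_response_tendsto summable_on_subset[OF u]) auto
  show "(\<lambda>K. \<Sum>j\<in>{- int K..b}. (norm (u j))\<^sup>2) \<longlonglongrightarrow> (\<Sum>\<^sub>\<infinity>j\<in>{..b}. (norm (u j))\<^sup>2)"
    by (rule sum_int_interval_tendsto_infsum[OF u])
qed (use truncated_response_contraction[OF I] in auto)

lemma l2_neg_summable_atMost: "u \<in> l2_neg \<Longrightarrow> (\<lambda>j. (norm (u j))\<^sup>2) summable_on {..-1}"
  using l2_neg_summable[of u] by (simp add: lessThan_0_int)

lemma inner_Wc_star:
  "cinner (Wc_star A B x n) v = (if n < 0 then cinner x ((A ^^ nat (- n - 1)) (B v)) else 0)"
  by (simp add: Wc_star_def cinner_cadjoint_left[OF B] cinner_cadjoint_funpow_left[OF A])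

lemma Wc_star_add: "Wc_star A B (x + y) n = Wc_star A B x n + Wc_star A B y n"
  and Wc_star_scaleC: "Wc_star A B (c *\<^sub>C x) n = c *\<^sub>C Wc_star A B x n"
proof -
  have add: "(cadjoint A ^^ k) (x + y) = (cadjoint A ^^ k) x + (cadjoint A ^^ k) y"
    and scale: "(cadjoint A ^^ k) (c *\<^sub>C x) = c *\<^sub>C (cadjoint A ^^ k) x" for k
    by (induction k) (simp_all add: cadjoint_add[OF A] cadjoint_scaleC[OF A])
  show "Wc_star A B (x + y) n = Wc_star A B x n + Wc_star A B y n"
    by (simp add: Wc_star_def add cadjoint_add[OF B])
  show "Wc_star A B (c *\<^sub>C x) n = c *\<^sub>C Wc_star A B x n"
    by (simp add: Wc_star_def scale cadjoint_scaleC[OF B])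
qed

lemma subspace_dom_Wc_star: "complex_vector.subspace (dom_Wc_star A B)"
proof (rule complex_vector.subspaceI)
  have "Wc_star A B 0 n = 0" for n
    using Wc_star_scaleC[of 0 0 n] by (simp add: complex_vector.scale_zero_left)
  then show "0 \<in> dom_Wc_star A B"
    by (simp add: dom_Wc_star_def l2_neg_def)
  show "x + y \<in> dom_Wc_star A B" if "x \<in> dom_Wc_star A B" "y \<in> dom_Wc_star A B" for x y
    using l2_neg_add[of "Wc_star A B x" "Wc_star A B y"] that
    by (simp add: dom_Wc_star_def Wc_star_add[abs_def])
  show "c *\<^sub>C x \<in> dom_Wc_star A B" if "x \<in> dom_Wc_star A B" for c x
    using l2_neg_scaleC[of "Wc_star A B x" c] that
    by (simp add: dom_Wc_star_def Wc_star_scaleC[abs_def])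
qed

lemma cinner_Wc_star_observability:
  assumes "n < 0"
  shows "cinner (Wc_star A B ((cadjoint A ^^ k) (cadjoint C y)) n) v = cinner y (F (nat (int k - n)) v)"
proof -
  have "nat (int k - n) = Suc (k + nat (- n - 1))"
    using assms by simp
  then show ?thesis
    using assms
    by (simp add: inner_Wc_star cinner_cadjoint_funpow_left[OF A] cinner_cadjoint_left[OF C] markov_def funpow_add)
qed

text \<open>Let \<open>g\<close> be the image of the vector under \<open>Wc_star\<close>, cut to a finite \<open>J\<close>. Using \<open>g\<close> itself as input,
  the output \<open>v\<close> at time \<open>k\<close> satisfies \<open>\<parallel>g\<parallel>\<^sup>2 = cinner y v \<le> \<parallel>y\<parallel> \<parallel>v\<parallel> \<le> \<parallel>y\<parallel> \<parallel>g\<parallel>\<close>, which bounds \<open>\<parallel>g\<parallel>\<close> by \<open>\<parallel>y\<parallel>\<close>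
  independently of \<open>J\<close>.\<close>
lemma observability_vector_in_dom_Wc_star: "(cadjoint A ^^ k) (cadjoint C y) \<in> dom_Wc_star A B"
proof -
  define g where "g = Wc_star A B ((cadjoint A ^^ k) (cadjoint C y))"
  have bound: "(\<Sum>n\<in>J. (norm (g n))\<^sup>2) \<le> (norm y)\<^sup>2" if J: "finite J" "J \<subseteq> {..<0}" for J
  proof -
    define s where "s = (\<Sum>n\<in>J. (norm (g n))\<^sup>2)"
    define v where "v = (\<Sum>n\<in>J. F (nat (int k - n)) (g n))"
    have s0: "s \<ge> 0"
      by (simp add: s_def sum_nonneg)
    have "complex_of_real s = (\<Sum>n\<in>J. cinner (g n) (g n))"
      by (simp add: s_def cinner_self)
    also have "\<dots> = cinner y v"
      unfolding v_def cinner_sum_right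
      by (intro sum.cong refl) (use J in \<open>auto simp: g_def cinner_Wc_star_observability\<close>)
    finally have "s \<le> norm y * norm v"
      by (metis Re_cinner Re_complex_of_real norm_cauchy_schwarz)
    then have "s\<^sup>2 \<le> (norm y)\<^sup>2 * (norm v)\<^sup>2"
      using s0 by (metis power_mono power_mult_distrib)
    also have "(norm v)\<^sup>2 \<le> s"
      unfolding v_def s_def using J by (intro norm_output_le) auto
    finally have "s * s \<le> (norm y)\<^sup>2 * s"
      by (simp add: power2_eq_square mult_left_mono)
    then show ?thesis
      using s0 unfolding s_def[symmetric] by (cases "s = 0") simp_all
  qed
  have "g \<in> l2_neg"
  proof (rule l2_negI)
    show "(\<lambda>n. (norm (g n))\<^sup>2) summable_on {..<0}"
      by (intro nonneg_bdd_above_summable_on bdd_aboveI2[of _ _ "(norm y)\<^sup>2"]) (use bound in auto)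
  qed (simp add: g_def Wc_star_def)
  then show ?thesis
    by (simp add: dom_Wc_star_def g_def)
qed

lemma dom_Wc_star_dense: "closure (dom_Wc_star A B) = UNIV"
proof -
  have "cspan (\<Union>k. range (\<lambda>y. (cadjoint A ^^ k) (cadjoint C y))) \<subseteq> dom_Wc_star A B"
    by (rule complex_vector.span_minimal[OF _ subspace_dom_Wc_star])
      (auto intro: observability_vector_in_dom_Wc_star)
  from closure_mono[OF this] have "UNIV \<subseteq> closure (dom_Wc_star A B)"
    by (simp only: observable)
  then show ?thesis
    by (rule top.extremum_uniqueI)
qed

lemma eq_if_cinner_eq_on_dom_Wc_star:
  assumes "\<And>x. x \<in> dom_Wc_star A B \<Longrightarrow> cinner x p = cinner x q"
  shows "p = q"
proof (rule cinner_eq_imp_eq)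
  fix x
  have "closed {x. cinner x (p - q) = 0}"
    using bounded_linear.continuous_on[OF bounded_linear_cinner_left continuous_on_id, of UNIV "p - q"]
    by (intro closed_Collect_eq) auto
  moreover have "dom_Wc_star A B \<subseteq> {x. cinner x (p - q) = 0}"
    using assms by (auto simp: cinner_diff_right)
  ultimately have "closure (dom_Wc_star A B) \<subseteq> {x. cinner x (p - q) = 0}"
    by (simp add: closure_minimal)
  then show "cinner x p = cinner x q"
    unfolding dom_Wc_star_dense by (auto simp: cinner_diff_right)
qed

text \<open>The graph of \<open>Wc\<close>. Proving membership in this relation avoids the definite description in the
  definition of \<open>Wc\<close>.\<close>
definition steers :: "(int \<Rightarrow> 'u) \<Rightarrow> 'x \<Rightarrow> bool" where
  "steers u x0 \<longleftrightarrow> u \<in> l2_neg \<and> (\<forall>x\<in>dom_Wc_star A B. l2_neg_inner (Wc_star A B x) u = cinner x x0)"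

text \<open>The description in the definition of \<open>Wc\<close> has a unique solution because a vector is determined by its
  inner products with the dense domain of \<open>Wc_star\<close>.\<close>
lemma steers_iff: "steers u x0 \<longleftrightarrow> u \<in> dom_Wc A B \<and> Wc A B u = x0"
proof -
  have Wc_eq: "Wc A B u = z" if z: "\<forall>x\<in>dom_Wc_star A B. l2_neg_inner (Wc_star A B x) u = cinner x z" for z
    unfolding Wc_def
  proof (rule the_equality)
    show "\<forall>x\<in>dom_Wc_star A B. l2_neg_inner (Wc_star A B x) u = cinner x z"
      by (rule z)
    fix z'
    assume z': "\<forall>x\<in>dom_Wc_star A B. l2_neg_inner (Wc_star A B x) u = cinner x z'"
    show "z' = z"
      by (rule eq_if_cinner_eq_on_dom_Wc_star) (metis z z')
  qed
  show ?thesis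
  proof
    assume st: "steers u x0"
    then have "u \<in> dom_Wc A B"
      unfolding steers_def dom_Wc_def by blast
    with st show "u \<in> dom_Wc A B \<and> Wc A B u = x0"
      unfolding steers_def by (intro conjI Wc_eq) simp_all
  next
    assume u: "u \<in> dom_Wc A B \<and> Wc A B u = x0"
    then obtain z where "u \<in> l2_neg"
      and z: "\<forall>x\<in>dom_Wc_star A B. l2_neg_inner (Wc_star A B x) u = cinner x z"
      unfolding dom_Wc_def by blast
    moreover have "z = x0"
      using Wc_eq[OF z] u by simp
    ultimately show "steers u x0"
      by (simp add: steers_def)
  qed
qed

lemma steers_l2_neg: "steers u x0 \<Longrightarrow> u \<in> l2_neg"
  by (simp add: steers_def)

lemma steers_diff:
  assumes "steers u x0" "steers v y0"
  shows "steers (\<lambda>n. u n - v n) (x0 - y0)"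
  using assms
  by (auto simp: steers_def l2_neg_diff l2_neg_inner_diff_right cinner_diff_right dom_Wc_star_def)

lemma steers_zero: "steers (\<lambda>_. 0) 0"
  by (simp add: steers_def l2_neg_def l2_neg_inner_def)

text \<open>Tested against \<open>y\<close>, the right side is the inner product of \<open>A*^m C* y\<close> with \<open>x0\<close>. As \<open>A*^m C* y\<close> lies
  in the domain of \<open>Wc_star\<close>, the steering relation turns it into the pairing of
  \<open>Wc_star (A*^m C* y)\<close> with \<open>u\<close>, whose entries are the Markov parameters.\<close>
lemma steers_free_response:
  assumes "steers u x0"
  shows "((\<lambda>j. F (nat (int m - j)) (u j)) has_sum C ((A ^^ m) x0)) {..<0}"
proof -
  have summ: "(\<lambda>j. F (nat (int m - j)) (u j)) summable_on {..<0}"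
    using l2_neg_summable[OF steers_l2_neg[OF assms]] by (intro output_summable) auto
  have "cinner y (\<Sum>\<^sub>\<infinity>j\<in>{..<0}. F (nat (int m - j)) (u j)) = cinner y (C ((A ^^ m) x0))" for y
  proof -
    define x where "x = (cadjoint A ^^ m) (cadjoint C y)"
    have "((\<lambda>j. cinner y (F (nat (int m - j)) (u j))) has_sum
        cinner y (\<Sum>\<^sub>\<infinity>j\<in>{..<0}. F (nat (int m - j)) (u j))) {..<0}"
      by (rule has_sum_bounded_linear[OF bounded_linear_cinner_right has_sum_infsum[OF summ]])
    then have "cinner y (\<Sum>\<^sub>\<infinity>j\<in>{..<0}. F (nat (int m - j)) (u j)) =
        (\<Sum>\<^sub>\<infinity>j\<in>{..<0}. cinner y (F (nat (int m - j)) (u j)))"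
      by (simp add: infsumI)
    also have "\<dots> = l2_neg_inner (Wc_star A B x) u"
      unfolding l2_neg_inner_def x_def
      by (intro infsum_cong) (simp add: cinner_Wc_star_observability)
    also have "\<dots> = cinner x x0"
      using assms observability_vector_in_dom_Wc_star by (simp add: steers_def x_def)
    also have "\<dots> = cinner y (C ((A ^^ m) x0))"
      by (simp add: x_def cinner_cadjoint_funpow_left[OF A] cinner_cadjoint_left[OF C])
    finally show ?thesis .
  qed
  then have "(\<Sum>\<^sub>\<infinity>j\<in>{..<0}. F (nat (int m - j)) (u j)) = C ((A ^^ m) x0)"
    by (rule cinner_eq_imp_eq)
  then show ?thesis
    using has_sum_infsum[OF summ] by simp
qed

definition truncate :: "nat \<Rightarrow> (int \<Rightarrow> 'u) \<Rightarrow> int \<Rightarrow> 'u" where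
  "truncate K u n = (if - int K \<le> n \<and> n < 0 then u n else 0)"

text \<open>The state at time \<open>0\<close> when the system is in the state \<open>0\<close> at time \<open>-K\<close> and then receives \<open>u\<close>.\<close>
definition reached_state :: "nat \<Rightarrow> (int \<Rightarrow> 'u) \<Rightarrow> 'x" where
  "reached_state K u = (\<Sum>n\<in>{- int K..-1}. (A ^^ nat (- n - 1)) (B (u n)))"

lemma cinner_reached_state:
  "cinner x (reached_state K u) = (\<Sum>n\<in>{- int K..-1}. cinner (Wc_star A B x n) (u n))"
  unfolding reached_state_def cinner_sum_right
  by (intro sum.cong refl) (simp add: inner_Wc_star)

lemma steers_truncate: "steers (truncate K u) (reached_state K u)"
  unfolding steers_def
proof (intro conjI ballI)
  have "(\<lambda>n. (norm (truncate K u n))\<^sup>2) summable_on {- int K..-1}"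
    by simp
  then have "(\<lambda>n. (norm (truncate K u n))\<^sup>2) summable_on {..<0}"
    by (rule summable_on_cong_neutral[THEN iffD1, rotated -1]) (auto simp: truncate_def)
  then show "truncate K u \<in> l2_neg"
    by (rule l2_negI[rotated]) (simp add: truncate_def)
  fix x
  have "l2_neg_inner (Wc_star A B x) (truncate K u) =
      (\<Sum>\<^sub>\<infinity>n\<in>{- int K..-1}. cinner (Wc_star A B x n) (u n))"
    unfolding l2_neg_inner_def by (rule infsum_cong_neutral) (auto simp: truncate_def)
  then show "l2_neg_inner (Wc_star A B x) (truncate K u) = cinner x (reached_state K u)"
    by (simp add: cinner_reached_state)
qed

text \<open>Both sides are pairings with \<open>Wc_star x\<close>, and those with the truncated input are the partial sums
  of a convergent series.\<close>
lemma reached_state_weak_tendsto: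
  assumes "steers u x0" "x \<in> dom_Wc_star A B"
  shows "(\<lambda>K. cinner x (reached_state K u)) \<longlonglongrightarrow> cinner x x0"
proof -
  have "cinner x x0 = (\<Sum>\<^sub>\<infinity>n\<in>{..-1}. cinner (Wc_star A B x n) (u n))"
    using assms by (simp add: steers_def l2_neg_inner_def lessThan_0_int)
  moreover have "(\<lambda>n. cinner (Wc_star A B x n) (u n)) summable_on {..-1}"
    using l2_neg_inner_summable[of "Wc_star A B x" u] assms
    by (simp add: steers_def dom_Wc_star_def lessThan_0_int)
  ultimately show ?thesis
    by (simp add: cinner_reached_state sum_int_interval_tendsto_infsum)
qed

text \<open>The difference \<open>x0 - reached_state K u\<close> is reached by the tail of \<open>u\<close> before time \<open>-K\<close>, whose
  norm tends to \<open>0\<close>.\<close>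
lemma reached_state_tendsto:
  assumes "Wc_bounded A B" "steers u x0"
  shows "(\<lambda>K. reached_state K u) \<longlonglongrightarrow> x0"
proof -
  obtain M where M: "\<forall>v\<in>dom_Wc A B. norm (Wc A B v) \<le> M * l2_neg_norm v"
    using assms(1) unfolding Wc_bounded_def by (elim exE)
  have bound: "norm y \<le> M * l2_neg_norm v" if "steers v y" for v y
    using bspec[OF M, of v] that[unfolded steers_iff] by (elim conjE) simp
  note u = l2_neg_summable_atMost[OF steers_l2_neg[OF assms(2)]]
  define e where "e = (\<Sum>\<^sub>\<infinity>n\<in>{..-1}. (norm (u n))\<^sup>2)"
  have tail: "l2_neg_norm (\<lambda>n. u n - truncate K u n) = sqrt (e - (\<Sum>n\<in>{- int K..-1}. (norm (u n))\<^sup>2))" for K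
  proof -
    have "(\<Sum>\<^sub>\<infinity>n\<in>{..<0}. (norm (u n - truncate K u n))\<^sup>2) = (\<Sum>\<^sub>\<infinity>n\<in>{..-1} - {- int K..-1}. (norm (u n))\<^sup>2)"
      by (rule infsum_cong_neutral) (auto simp: truncate_def)
    also have "\<dots> = e - (\<Sum>\<^sub>\<infinity>n\<in>{- int K..-1}. (norm (u n))\<^sup>2)"
      unfolding e_def by (rule infsum_Diff) (use u in auto)
    finally show ?thesis
      by (simp add: l2_neg_norm_def)
  qed
  have "norm (x0 - reached_state K u) \<le> M * sqrt (e - (\<Sum>n\<in>{- int K..-1}. (norm (u n))\<^sup>2))" for K
    using bound[OF steers_diff[OF assms(2) steers_truncate[of K u]]] unfolding tail .
  then have le: "\<forall>K. norm (x0 - reached_state K u) \<le> M * sqrt (e - (\<Sum>n\<in>{- int K..-1}. (norm (u n))\<^sup>2))"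
    by (rule allI)
  have "(\<lambda>K. M * sqrt (e - (\<Sum>n\<in>{- int K..-1}. (norm (u n))\<^sup>2))) \<longlonglongrightarrow> M * sqrt (e - e)"
    unfolding e_def by (intro tendsto_intros sum_int_interval_tendsto_infsum u)
  then have lim: "(\<lambda>K. M * sqrt (e - (\<Sum>n\<in>{- int K..-1}. (norm (u n))\<^sup>2))) \<longlonglongrightarrow> 0"
    by (simp only: diff_self real_sqrt_zero mult_zero_right)
  have "(\<lambda>K. x0 - reached_state K u) \<longlonglongrightarrow> 0"
    by (rule Lim_null_comparison[OF always_eventually[OF le] lim])
  from tendsto_diff[OF tendsto_const[of x0] this] show ?thesis
    by simp
qed

end

section \<open>Shifted inputs and the energy of future trajectories\<close>
text \<open>Moves a sequence on the negative integers one step into the past and puts \<open>a\<close> at time \<open>-1\<close>: what an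
  observer at time \<open>0\<close> sees one time step later.\<close>
definition shift_in :: "'a \<Rightarrow> (int \<Rightarrow> 'a) \<Rightarrow> int \<Rightarrow> 'a :: zero" where
  "shift_in a u n = (if n < -1 then u (n + 1) else if n = -1 then a else 0)"

lemma has_sum_shift_in:
  fixes h :: "int \<Rightarrow> 'b :: topological_comm_monoid_add"
  assumes "((\<lambda>n. h (n - 1)) has_sum s) {..<0}"
  shows "(h has_sum (h (-1) + s)) {..<0}"
proof -
  have "(h has_sum s) {..<-1}"
    using assms
    by (rule has_sum_reindex_bij_witness[of _ "\<lambda>n. n - 1" "\<lambda>n. n + 1", THEN iffD2, rotated -1]) auto
  then have "(h has_sum (h (-1) + s)) (insert (-1) {..<-1})"
    by (rule has_sum_insert[rotated]) simp
  moreover have "insert (-1) {..<-1} = {..<0::int}"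
    by auto
  ultimately show ?thesis
    by simp
qed

lemma l2_neg_shift_in:
  fixes u :: "int \<Rightarrow> 'a :: complex_hilbert"
  assumes "u \<in> l2_neg"
  shows "shift_in a u \<in> l2_neg"
    and "(l2_neg_norm (shift_in a u))\<^sup>2 = (norm a)\<^sup>2 + (l2_neg_norm u)\<^sup>2"
proof -
  have "((\<lambda>n. (norm (shift_in a u (n - 1)))\<^sup>2) has_sum (l2_neg_norm u)\<^sup>2) {..<0}"
    unfolding l2_neg_norm_squared
    using has_sum_infsum[OF l2_neg_summable[OF assms]]
    by (rule has_sum_cong[THEN iffD1, rotated]) (simp add: shift_in_def)
  then have "((\<lambda>n. (norm (shift_in a u n))\<^sup>2) has_sum ((norm a)\<^sup>2 + (l2_neg_norm u)\<^sup>2)) {..<0}"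
    using has_sum_shift_in[of "\<lambda>n. (norm (shift_in a u n))\<^sup>2"] by (simp add: shift_in_def)
  then show "shift_in a u \<in> l2_neg" "(l2_neg_norm (shift_in a u))\<^sup>2 = (norm a)\<^sup>2 + (l2_neg_norm u)\<^sup>2"
    by (auto simp: l2_neg_norm_squared infsumI shift_in_def intro!: l2_negI has_sum_imp_summable)
qed

context contractive_observable_system
begin

lemma dom_Wc_star_cadjoint:
  assumes "x \<in> dom_Wc_star A B"
  shows "cadjoint A x \<in> dom_Wc_star A B"
    and "n < 0 \<Longrightarrow> Wc_star A B (cadjoint A x) n = Wc_star A B x (n - 1)"
proof -
  show shift: "Wc_star A B (cadjoint A x) n = Wc_star A B x (n - 1)" if "n < 0" for n
  proof -
    have "nat (- (n - 1) - 1) = Suc (nat (- n - 1))"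
      using that by simp
    then show ?thesis
      using that by (simp add: Wc_star_def funpow_swap1)
  qed
  have "(\<lambda>n. (norm (Wc_star A B x n))\<^sup>2) summable_on {..<-1}"
    using assms by (intro summable_on_subset[OF l2_neg_summable]) (auto simp: dom_Wc_star_def)
  then have "(\<lambda>n. (norm (Wc_star A B x (n - 1)))\<^sup>2) summable_on {..<0}"
    by (rule summable_on_reindex_bij_witness[of _ "\<lambda>n. n + 1" "\<lambda>n. n - 1", THEN iffD2, rotated -1]) auto
  then have "(\<lambda>n. (norm (Wc_star A B (cadjoint A x) n))\<^sup>2) summable_on {..<0}"
    by (rule summable_on_cong[THEN iffD1, rotated]) (simp add: shift)
  then show "cadjoint A x \<in> dom_Wc_star A B"
    by (auto simp: dom_Wc_star_def Wc_star_def intro!: l2_negI)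
qed

text \<open>One step of the system: the shifted entries pair with \<open>Wc_star x\<close> as the original ones do with
  \<open>Wc_star (A* x)\<close>, which contributes \<open>A x0\<close>, and the new entry contributes \<open>B u0\<close>.\<close>
lemma steers_shift_in:
  assumes "steers u x0"
  shows "steers (shift_in u0 u) (A x0 + B u0)"
  unfolding steers_def
proof (intro conjI ballI)
  show "shift_in u0 u \<in> l2_neg"
    by (rule l2_neg_shift_in[OF steers_l2_neg[OF assms]])
  fix x assume x: "x \<in> dom_Wc_star A B"
  define h where "h n = cinner (Wc_star A B x n) (shift_in u0 u n)" for n
  have "cadjoint A x \<in> dom_Wc_star A B"
    by (rule dom_Wc_star_cadjoint[OF x])
  then have "((\<lambda>n. cinner (Wc_star A B (cadjoint A x) n) (u n)) has_sum cinner (cadjoint A x) x0) {..<0}"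
    using assms has_sum_infsum[OF l2_neg_inner_summable[of "Wc_star A B (cadjoint A x)" u]]
    by (simp add: steers_def dom_Wc_star_def l2_neg_inner_def)
  then have "((\<lambda>n. h (n - 1)) has_sum cinner (cadjoint A x) x0) {..<0}"
    by (rule has_sum_cong[THEN iffD1, rotated]) (simp add: h_def shift_in_def dom_Wc_star_cadjoint(2)[OF x])
  then have "(h has_sum (h (-1) + cinner (cadjoint A x) x0)) {..<0}"
    by (rule has_sum_shift_in)
  moreover have "h (-1) = cinner x (B u0)"
    by (simp add: h_def shift_in_def inner_Wc_star)
  ultimately show "l2_neg_inner (Wc_star A B x) (shift_in u0 u) = cinner x (A x0 + B u0)"
    unfolding l2_neg_inner_def h_def[symmetric]
    by (simp add: infsumI cinner_add_right cinner_cadjoint_left[OF A] add.commute)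
qed

lemma toeplitz_neg_l2_neg:
  assumes u: "u \<in> l2_neg"
  shows "toeplitz_neg A B C D u \<in> l2_neg"
proof (rule l2_negI)
  have "(\<Sum>i\<in>I. (norm (response u i))\<^sup>2) \<le> (\<Sum>\<^sub>\<infinity>j\<in>{..-1}. (norm (u j))\<^sup>2)"
    if "finite I" "I \<subseteq> {..<0}" for I
    using that by (intro response_contraction l2_neg_summable_atMost[OF u]) (auto simp: lessThan_0_int)
  then have "(\<lambda>i. (norm (response u i))\<^sup>2) summable_on {..<0}"
    by (intro nonneg_bdd_above_summable_on) (auto intro!: bdd_aboveI)
  then show "(\<lambda>i. (norm (toeplitz_neg A B C D u i))\<^sup>2) summable_on {..<0}"
    by (rule summable_on_cong[THEN iffD1, rotated]) (simp add: toeplitz_neg_eq_response)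
qed (simp add: toeplitz_neg_eq_response)

text \<open>The new last output is the response of \<open>u\<close> at time \<open>0\<close>, which is \<open>C x0\<close>, plus \<open>D u0\<close>. The earlier
  outputs are only shifted, because the Toeplitz operator is causal and time-invariant.\<close>
lemma toeplitz_neg_shift_in:
  assumes "steers u x0"
  shows "toeplitz_neg A B C D (shift_in u0 u) = shift_in (C x0 + D u0) (toeplitz_neg A B C D u)"
proof
  fix i :: int
  consider "i \<ge> 0" | "i = -1" | "i < -1"
    by linarith
  then show "toeplitz_neg A B C D (shift_in u0 u) i = shift_in (C x0 + D u0) (toeplitz_neg A B C D u) i"
  proof cases
    case 2
    define h where "h n = F (nat (- 1 - n)) (shift_in u0 u n)" for n
    have "((\<lambda>j. F (nat (int 0 - j)) (u j)) has_sum C ((A ^^ 0) x0)) {..<0}"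
      by (rule steers_free_response[OF assms])
    then have "((\<lambda>n. h (n - 1)) has_sum C x0) {..<0}"
      unfolding funpow_0 by (rule has_sum_cong[THEN iffD1, rotated]) (simp add: h_def shift_in_def)
    then have "(h has_sum (h (-1) + C x0)) {..-1}"
      unfolding lessThan_0_int[symmetric] by (rule has_sum_shift_in)
    then show ?thesis
      using 2 by (simp add: toeplitz_neg_def h_def[symmetric] infsumI) 
        (simp add: h_def shift_in_def markov_def add.commute)
  next
    case 3
    have "(\<Sum>\<^sub>\<infinity>j\<in>{..i}. F (nat (i - j)) (shift_in u0 u j)) = (\<Sum>\<^sub>\<infinity>j\<in>{..i + 1}. F (nat (i + 1 - j)) (u j))"
      using 3 by (intro infsum_reindex_bij_witness[of _ "\<lambda>j. j - 1" "\<lambda>j. j + 1"])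
        (auto simp: shift_in_def)
    then show ?thesis
      using 3 by (simp add: toeplitz_neg_def shift_in_def)
  qed (simp add: toeplitz_neg_def shift_in_def)
qed

abbreviation net_supply :: "(int \<Rightarrow> 'u) \<Rightarrow> real" where
  "net_supply u \<equiv> (l2_neg_norm u)\<^sup>2 - (l2_neg_norm (toeplitz_neg A B C D u))\<^sup>2"

lemma le_net_supplyI:
  assumes u: "u \<in> l2_neg"
    and bound: "\<And>I. finite I \<Longrightarrow> I \<subseteq> {..<0} \<Longrightarrow> (\<Sum>i\<in>I. (norm (response u i))\<^sup>2) \<le> (l2_neg_norm u)\<^sup>2 - c"
  shows "c \<le> net_supply u"
proof -
  have "(l2_neg_norm (toeplitz_neg A B C D u))\<^sup>2 \<le> (l2_neg_norm u)\<^sup>2 - c"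
    unfolding l2_neg_norm_squared[of "toeplitz_neg A B C D u"]
  proof (rule infsum_le_finite_sums[OF l2_neg_summable[OF toeplitz_neg_l2_neg[OF u]]])
    fix I :: "int set" assume I: "finite I" "I \<subseteq> {..<0}"
    have "(\<Sum>i\<in>I. (norm (toeplitz_neg A B C D u i))\<^sup>2) = (\<Sum>i\<in>I. (norm (response u i))\<^sup>2)"
      using I by (intro sum.cong) (auto simp: toeplitz_neg_eq_response)
    then show "(\<Sum>i\<in>I. (norm (toeplitz_neg A B C D u i))\<^sup>2) \<le> (l2_neg_norm u)\<^sup>2 - c"
      using bound[OF I] by simp
  qed
  then show ?thesis by simp
qed

lemma trajectory_state:
  assumes "trajectory A B C D N0 u x y"
  shows "x (N0 + int m) = (A ^^ m) (x N0) + (\<Sum>j\<in>{N0..<N0 + int m}. (A ^^ nat (N0 + int m - 1 - j)) (B (u j)))"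
proof (induction m)
  case (Suc m)
  note linA = bounded_linear.linear[OF bounded_clinear_imp_bounded_linear[OF A]]
  have "A (\<Sum>j\<in>{N0..<N0 + int m}. (A ^^ nat (N0 + int m - 1 - j)) (B (u j))) =
      (\<Sum>j\<in>{N0..<N0 + int m}. (A ^^ nat (N0 + int (Suc m) - 1 - j)) (B (u j)))"
    unfolding linear_sum[OF linA]
  proof (intro sum.cong refl)
    fix j assume "j \<in> {N0..<N0 + int m}"
    then have "nat (N0 + int (Suc m) - 1 - j) = Suc (nat (N0 + int m - 1 - j))"
      by auto
    then show "A ((A ^^ nat (N0 + int m - 1 - j)) (B (u j))) = (A ^^ nat (N0 + int (Suc m) - 1 - j)) (B (u j))"
      by simp
  qed
  moreover have "x (N0 + int (Suc m)) = A (x (N0 + int m)) + B (u (N0 + int m))"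
    using assms by (simp add: trajectory_def add.assoc[symmetric] add.commute[of 1])
  moreover have "{N0..<N0 + int (Suc m)} = insert (N0 + int m) {N0..<N0 + int m}"
    by auto
  ultimately show ?case
    using Suc by (simp add: linear_add[OF linA] add.assoc add.commute)
qed simp

lemma trajectory_output:
  assumes "trajectory A B C D N0 u x y"
  shows "y (N0 + int m) = C ((A ^^ m) (x N0)) + (\<Sum>j\<in>{N0..N0 + int m}. F (nat (N0 + int m - j)) (u j))"
proof -
  note linC = bounded_linear.linear[OF bounded_clinear_imp_bounded_linear[OF C]]
  have "C (\<Sum>j\<in>{N0..<N0 + int m}. (A ^^ nat (N0 + int m - 1 - j)) (B (u j))) =
      (\<Sum>j\<in>{N0..<N0 + int m}. F (nat (N0 + int m - j)) (u j))"
    unfolding linear_sum[OF linC]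
  proof (intro sum.cong refl)
    fix j assume "j \<in> {N0..<N0 + int m}"
    then have "nat (N0 + int m - j) = Suc (nat (N0 + int m - 1 - j))"
      by auto
    then show "C ((A ^^ nat (N0 + int m - 1 - j)) (B (u j))) = F (nat (N0 + int m - j)) (u j)"
      by (simp add: markov_def)
  qed
  moreover have "y (N0 + int m) = C (x (N0 + int m)) + D (u (N0 + int m))"
    using assms by (simp add: trajectory_def)
  moreover have "{N0..N0 + int m} = insert (N0 + int m) {N0..<N0 + int m}"
    by auto
  ultimately show ?thesis
    by (simp add: trajectory_state[OF assms] linear_add[OF linC] markov_def add.assoc add.commute)
qed

text \<open>Let \<open>w\<close> be \<open>u\<close> in the past followed by \<open>v\<close> in the future. Its response is that of \<open>u\<close> at negative
  times, and at nonnegative times it is \<open>y\<close>, since the past input contributes \<open>C (A^m x0)\<close>, just as the initial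
  state \<open>x0\<close> does. The contraction property for \<open>w\<close> up to time \<open>n1\<close> is the claim.\<close>
lemma future_energy_le_net_supply:
  assumes st: "steers u x0" and tr: "trajectory A B C D 0 v x y" and x0: "x 0 = x0"
  shows "(\<Sum>n\<in>{0..n1}. (norm (y n))\<^sup>2 - (norm (v n))\<^sup>2) \<le> net_supply u"
proof (rule le_net_supplyI[OF steers_l2_neg[OF st]])
  fix I :: "int set" assume I: "finite I" "I \<subseteq> {..<0}"
  define w where "w j = (if j < 0 then u j else v j)" for j
  have past: "((\<lambda>j. (norm (w j))\<^sup>2) has_sum (l2_neg_norm u)\<^sup>2) {..<0}"
    unfolding l2_neg_norm_squared
    using has_sum_infsum[OF l2_neg_summable[OF steers_l2_neg[OF st]]]
    by (rule has_sum_cong[THEN iffD1, rotated]) (simp add: w_def)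
  have "((\<lambda>j. (norm (w j))\<^sup>2) has_sum ((l2_neg_norm u)\<^sup>2 + (\<Sum>n\<in>{0..n1}. (norm (w n))\<^sup>2))) ({..<0} \<union> {0..n1})"
    by (rule has_sum_Un_disjoint[OF past has_sum_finite]) auto
  moreover have "(\<Sum>n\<in>{0..n1}. (norm (w n))\<^sup>2) = (\<Sum>n\<in>{0..n1}. (norm (v n))\<^sup>2)"
    by (intro sum.cong) (auto simp: w_def)
  ultimately have total: "((\<lambda>j. (norm (w j))\<^sup>2) has_sum ((l2_neg_norm u)\<^sup>2 + (\<Sum>n\<in>{0..n1}. (norm (v n))\<^sup>2))) ({..<0} \<union> {0..n1})"
    by simp
  have past_response: "response w i = response u i" if "i < 0" for i
    unfolding response_def by (rule infsum_cong) (use that in \<open>auto simp: w_def\<close>)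
  have future_response: "response w i = y i" if "i \<ge> 0" for i
  proof -
    define m where "m = nat i"
    have i: "i = int m"
      using that by (simp add: m_def)
    have "((\<lambda>j. F (nat (int m - j)) (w j)) has_sum C ((A ^^ m) x0)) {..<0}"
      using steers_free_response[OF st, of m]
      by (rule has_sum_cong[THEN iffD1, rotated]) (simp add: w_def)
    then have "((\<lambda>j. F (nat (int m - j)) (w j)) has_sum
        (C ((A ^^ m) x0) + (\<Sum>j\<in>{0..int m}. F (nat (int m - j)) (w j)))) ({..<0} \<union> {0..int m})"
      by (rule has_sum_Un_disjoint[OF _ has_sum_finite]) auto
    moreover have "{..<0} \<union> {0..int m} = {..int m}"
      by auto
    moreover have "(\<Sum>j\<in>{0..int m}. F (nat (int m - j)) (w j)) = (\<Sum>j\<in>{0..int m}. F (nat (int m - j)) (v j))"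
      by (intro sum.cong) (auto simp: w_def)
    ultimately have "response w i = C ((A ^^ m) x0) + (\<Sum>j\<in>{0..int m}. F (nat (int m - j)) (v j))"
      by (simp add: response_def i infsumI)
    then show ?thesis
      using trajectory_output[OF tr, of m] by (simp add: i x0)
  qed
  have "(\<Sum>i\<in>I. (norm (response u i))\<^sup>2) + (\<Sum>i\<in>{0..n1}. (norm (y i))\<^sup>2) =
      (\<Sum>i\<in>I. (norm (response w i))\<^sup>2) + (\<Sum>i\<in>{0..n1}. (norm (response w i))\<^sup>2)"
    using I by (intro arg_cong2[of _ _ _ _ "(+)"] sum.cong) (auto simp: past_response future_response)
  also have "\<dots> = (\<Sum>i\<in>I \<union> {0..n1}. (norm (response w i))\<^sup>2)"
    using I by (intro sum.union_disjoint[symmetric]) auto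
  also have "\<dots> \<le> (l2_neg_norm u)\<^sup>2 + (\<Sum>n\<in>{0..n1}. (norm (v n))\<^sup>2)"
  proof -
    \<comment> \<open>For negative \<open>n1\<close> the future window is empty and the past ends at \<open>-1\<close>.\<close>
    define b where "b = max n1 (-1)"
    have b: "{..<0} \<union> {0..n1} = {..b}"
      by (auto simp: b_def)
    have "(\<Sum>i\<in>I \<union> {0..n1}. (norm (response w i))\<^sup>2) \<le> (\<Sum>\<^sub>\<infinity>j\<in>{..b}. (norm (w j))\<^sup>2)"
      using I by (intro response_contraction has_sum_imp_summable[OF total[unfolded b]])
        (auto simp: b[symmetric])
    then show ?thesis
      by (simp add: infsumI[OF total[unfolded b]])
  qed
  finally show "(\<Sum>i\<in>I. (norm (response u i))\<^sup>2) \<le>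
      (l2_neg_norm u)\<^sup>2 - (\<Sum>n\<in>{0..n1}. (norm (y n))\<^sup>2 - (norm (v n))\<^sup>2)"
    by (simp add: sum_subtractf)
qed

end

section \<open>Storage functions\<close>
lemma storage_functionI:
  assumes "\<And>x. 0 \<le> S x" and "S 0 = 0"
    and step: "\<And>x u. S (A x + B u) \<le> S x + ereal ((norm u)\<^sup>2) - ereal ((norm (C x + D u))\<^sup>2)"
  shows "storage_function A B C D S"
  using assms unfolding storage_function_def trajectory_def by simp

lemma trajectory_exists: "\<exists>x y. trajectory A B C D N0 u x y \<and> x N0 = x0"
proof -
  define X where "X = rec_nat x0 (\<lambda>m z. A z + B (u (N0 + int m)))"
  define x where "x n = X (nat (n - N0))" for n
  have "trajectory A B C D N0 u x (\<lambda>n. C (x n) + D (u n))"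
    unfolding trajectory_def
  proof (intro allI impI conjI refl)
    fix n assume "N0 \<le> n"
    then have "nat (n + 1 - N0) = Suc (nat (n - N0))" "N0 + int (nat (n - N0)) = n"
      by auto
    then show "x (n + 1) = A (x n) + B (u n)"
      by (simp add: x_def X_def)
  qed
  moreover have "x N0 = x0"
    by (simp add: x_def X_def)
  ultimately show ?thesis
    by blast
qed

lemma storage_function_le_supplied_energy:
  assumes S: "storage_function A B C D S"
    and tr: "trajectory A B C D N0 u x y" and start: "x N0 = 0"
  shows "S (x (N0 + int m)) \<le> ereal (\<Sum>n\<in>{N0..<N0 + int m}. (norm (u n))\<^sup>2 - (norm (y n))\<^sup>2)"
proof (induction m)
  case 0
  then show ?case
    using S start by (simp add: storage_function_def zero_ereal_def)
next
  case (Suc m)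
  define n where "n = N0 + int m"
  have "S (x (n + 1)) \<le> S (x n) + ereal ((norm (u n))\<^sup>2) - ereal ((norm (y n))\<^sup>2)"
    using S tr by (simp add: storage_function_def n_def)
  also have "\<dots> \<le> ereal (\<Sum>n\<in>{N0..<n}. (norm (u n))\<^sup>2 - (norm (y n))\<^sup>2) + ereal ((norm (u n))\<^sup>2) - ereal ((norm (y n))\<^sup>2)"
    using Suc unfolding n_def[symmetric] by (intro ereal_minus_mono add_right_mono order_refl)
  also have "\<dots> = ereal (\<Sum>n\<in>{N0..<n + 1}. (norm (u n))\<^sup>2 - (norm (y n))\<^sup>2)"
  proof -
    have "{N0..<n + 1} = insert n {N0..<n}"
      by (auto simp: n_def)
    then show ?thesis
      by simp
  qed
  finally show ?case
    by (simp add: n_def algebra_simps)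
qed

context contractive_observable_system
begin

lemma available_storage_upper:
  assumes "trajectory A B C D 0 u x y" "0 \<le> n1"
  shows "ereal (\<Sum>n\<in>{0..n1}. (norm (y n))\<^sup>2 - (norm (u n))\<^sup>2) \<le> available_storage A B C D (x 0)"
  unfolding available_storage_def using assms by (intro Sup_upper) blast

text \<open>Past inputs that reach \<open>x0\<close> and future trajectories that leave it can be combined freely, so the
  bound on the energy of a combination passes to the supremum and the infimum.\<close>
lemma available_storage_le_required_supply:
  "available_storage A B C D x0 \<le> l2_required_supply A B C D x0"
  unfolding available_storage_def l2_required_supply_def
proof (intro Sup_least Inf_greatest)
  fix a b
  assume "a \<in> {ereal (\<Sum>n\<in>{0..n1}. (norm (y n))\<^sup>2 - (norm (u n))\<^sup>2) | n1 u x y.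
      0 \<le> n1 \<and> trajectory A B C D 0 u x y \<and> x 0 = x0}"
    and "b \<in> {ereal (net_supply u) | u. u \<in> dom_Wc A B \<and> Wc A B u = x0}"
  then show "a \<le> b"
    by (auto simp: steers_iff[symmetric] intro: future_energy_le_net_supply)
qed

lemma available_storage_nonneg: "0 \<le> available_storage A B C D x0"
proof -
  obtain x y where tr: "trajectory A B C D 0 (\<lambda>_. 0) x y" and x0: "x 0 = x0"
    using trajectory_exists[of A B C D 0 "\<lambda>_. 0" x0] by blast
  have "0 \<le> ereal (\<Sum>n\<in>{0..0}. (norm (y n))\<^sup>2 - (norm (0 :: 'u))\<^sup>2)"
    by simp
  also have "\<dots> \<le> available_storage A B C D x0"
    using available_storage_upper[OF tr, of 0] x0 by simp
  finally show ?thesis .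
qed

lemma required_supply_le_net_supply:
  "steers u x0 \<Longrightarrow> l2_required_supply A B C D x0 \<le> ereal (net_supply u)"
  unfolding l2_required_supply_def steers_iff by (intro Inf_lower) blast

lemma required_supply_nonneg: "0 \<le> l2_required_supply A B C D x0"
  by (rule order_trans[OF available_storage_nonneg available_storage_le_required_supply])

lemma required_supply_zero: "l2_required_supply A B C D 0 = 0"
proof (rule antisym[OF _ required_supply_nonneg])
  have "l2_required_supply A B C D 0 \<le> ereal (net_supply (\<lambda>_. 0))"
    by (rule required_supply_le_net_supply[OF steers_zero])
  also have "\<dots> \<le> 0"
    by (simp add: l2_neg_norm_def)
  finally show "l2_required_supply A B C D 0 \<le> 0" .
qed

lemma available_storage_zero: "available_storage A B C D 0 = 0"
  using available_storage_le_required_supply[of 0] available_storage_nonneg[of 0]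
  by (simp add: required_supply_zero)

text \<open>A trajectory from \<open>A x0 + B u0\<close>, delayed by one step and preceded by the input \<open>u0\<close> at the state
  \<open>x0\<close>, is a trajectory from \<open>x0\<close>.\<close>
lemma available_storage_step:
  "available_storage A B C D (A x0 + B u0) \<le>
    available_storage A B C D x0 + ereal ((norm u0)\<^sup>2) - ereal ((norm (C x0 + D u0))\<^sup>2)"
proof -
  define c where "c = (norm (C x0 + D u0))\<^sup>2 - (norm u0)\<^sup>2"
  have "available_storage A B C D (A x0 + B u0) \<le> available_storage A B C D x0 - ereal c"
    unfolding available_storage_def[of A B C D "A x0 + B u0"]
  proof (rule Sup_least, clarify)
    fix n1 u x y
    assume n1: "(0::int) \<le> n1" and tr: "trajectory A B C D 0 u x y" and start: "x 0 = A x0 + B u0"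
    define u' where "u' n = (if n \<le> 0 then u0 else u (n - 1))" for n
    define x' where "x' n = (if n \<le> 0 then x0 else x (n - 1))" for n
    define y' where "y' n = (if n \<le> 0 then C x0 + D u0 else y (n - 1))" for n
    have "trajectory A B C D 0 u' x' y'"
      unfolding trajectory_def
    proof (intro allI impI)
      fix n :: int assume "0 \<le> n"
      show "x' (n + 1) = A (x' n) + B (u' n) \<and> y' n = C (x' n) + D (u' n)"
      proof (cases "n = 0")
        case False
        then have "n - 1 \<ge> 0"
          using \<open>0 \<le> n\<close> by simp
        then have "x (n - 1 + 1) = A (x (n - 1)) + B (u (n - 1)) \<and> y (n - 1) = C (x (n - 1)) + D (u (n - 1))"
          using tr unfolding trajectory_def by blast
        then show ?thesis
          using False \<open>0 \<le> n\<close> by (simp add: x'_def u'_def y'_def)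
      qed (simp add: x'_def u'_def y'_def start)
    qed
    from available_storage_upper[OF this, of "n1 + 1"] n1
    have "ereal (\<Sum>n\<in>{0..n1 + 1}. (norm (y' n))\<^sup>2 - (norm (u' n))\<^sup>2) \<le> available_storage A B C D x0"
      by (simp add: x'_def)
    also have "(\<Sum>n\<in>{0..n1 + 1}. (norm (y' n))\<^sup>2 - (norm (u' n))\<^sup>2) =
        c + (\<Sum>n\<in>{1..n1 + 1}. (norm (y' n))\<^sup>2 - (norm (u' n))\<^sup>2)"
    proof -
      have "{0..n1 + 1} = insert 0 {1..n1 + 1}"
        using n1 by auto
      then show ?thesis
        by (simp add: c_def y'_def u'_def)
    qed
    also have "(\<Sum>n\<in>{1..n1 + 1}. (norm (y' n))\<^sup>2 - (norm (u' n))\<^sup>2) =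
        (\<Sum>n\<in>{0..n1}. (norm (y n))\<^sup>2 - (norm (u n))\<^sup>2)"
      by (rule sum.reindex_bij_witness[of _ "\<lambda>n. n + 1" "\<lambda>n. n - 1"]) (auto simp: y'_def u'_def)
    finally show "ereal (\<Sum>n\<in>{0..n1}. (norm (y n))\<^sup>2 - (norm (u n))\<^sup>2) \<le> available_storage A B C D x0 - ereal c"
      by (cases "available_storage A B C D x0") auto
  qed
  then show ?thesis
    by (cases "available_storage A B C D x0") (auto simp: c_def algebra_simps)
qed

text \<open>If \<open>u\<close> steers to \<open>x0\<close>, then the shifted input with \<open>u0\<close> appended steers to \<open>A x0 + B u0\<close>; it changes the
  net supply by \<open>\<parallel>u0\<parallel>\<^sup>2 - \<parallel>C x0 + D u0\<parallel>\<^sup>2\<close>.\<close>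
lemma required_supply_step:
  "l2_required_supply A B C D (A x0 + B u0) \<le>
    l2_required_supply A B C D x0 + ereal ((norm u0)\<^sup>2) - ereal ((norm (C x0 + D u0))\<^sup>2)"
proof -
  define c where "c = (norm u0)\<^sup>2 - (norm (C x0 + D u0))\<^sup>2"
  have "l2_required_supply A B C D (A x0 + B u0) - ereal c \<le> l2_required_supply A B C D x0"
    unfolding l2_required_supply_def[of A B C D x0]
  proof (rule Inf_greatest, clarify)
    fix u assume "u \<in> dom_Wc A B" "x0 = Wc A B u"
    then have st: "steers u x0"
      by (simp add: steers_iff)
    have "l2_required_supply A B C D (A x0 + B u0) \<le> ereal (net_supply (shift_in u0 u))"
      by (rule required_supply_le_net_supply[OF steers_shift_in[OF st]])
    also have "net_supply (shift_in u0 u) = net_supply u + c"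
      unfolding toeplitz_neg_shift_in[OF st] l2_neg_shift_in(2)[OF steers_l2_neg[OF st]]
        l2_neg_shift_in(2)[OF toeplitz_neg_l2_neg[OF steers_l2_neg[OF st]]] c_def by simp
    finally show "l2_required_supply A B C D (A (Wc A B u) + B u0) - ereal c \<le> ereal (net_supply u)"
      unfolding \<open>x0 = Wc A B u\<close>
      by (cases "l2_required_supply A B C D (A (Wc A B u) + B u0)") auto
  qed
  then show ?thesis
    by (cases "l2_required_supply A B C D x0"; cases "l2_required_supply A B C D (A x0 + B u0)")
      (auto simp: c_def algebra_simps)
qed

lemma required_supply_finite:
  assumes "x0 \<in> Im_Wc A B"
  shows "l2_required_supply A B C D x0 < \<infinity>"
proof -
  obtain u where "steers u x0"
    using assms by (auto simp: steers_iff)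
  from required_supply_le_net_supply[OF this] show ?thesis
    by (rule le_less_trans) simp
qed

lemma l2_regular_required_supply: "l2_regular_storage_function A B C D (l2_required_supply A B C D)"
  unfolding l2_regular_storage_function_def
  by (intro conjI ballI storage_functionI required_supply_nonneg required_supply_zero
      required_supply_step required_supply_finite)

lemma l2_regular_available_storage: "l2_regular_storage_function A B C D (available_storage A B C D)"
  unfolding l2_regular_storage_function_def
  by (intro conjI ballI storage_functionI available_storage_nonneg available_storage_zero
      available_storage_step le_less_trans[OF available_storage_le_required_supply required_supply_finite])

text \<open>Dropping the output energy at times outside \<open>I\<close> weakens the bound, but leaves a finite sum over an
  index set independent of \<open>K\<close>, so that the limit of large \<open>K\<close> can be taken termwise.\<close>
lemma storage_reached_state_le:
  assumes S: "storage_function A B C D S" and I: "finite I" "I \<subseteq> {..-1}"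
  shows "S (reached_state K u) \<le> ereal ((\<Sum>n\<in>{- int K..-1}. (norm (u n))\<^sup>2) -
    (\<Sum>i\<in>I. (norm (\<Sum>j\<in>{- int K..i}. F (nat (i - j)) (u j)))\<^sup>2))"
proof -
  define out where "out i = (\<Sum>j\<in>{- int K..i}. F (nat (i - j)) (u j))" for i
  obtain x y where tr: "trajectory A B C D (- int K) u x y" and start: "x (- int K) = 0"
    using trajectory_exists[of A B C D "- int K" u 0] by blast
  have zero: "(A ^^ m) 0 = 0" "C 0 = 0" for m
    by (simp_all add: linear_0 bounded_linear.linear bounded_clinear_imp_bounded_linear
        bounded_clinear_funpow A C)
  have interval: "{- int K..<0} = {- int K..-1}"
    by auto
  have "nat (- 1 - j) = nat (- j - 1)" for j
    by (rule arg_cong[of _ _ nat]) simp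
  then have "x 0 = reached_state K u"
    using trajectory_state[OF tr, of K] by (simp add: start zero reached_state_def interval)
  then have "S (reached_state K u) \<le> ereal (\<Sum>n\<in>{- int K..-1}. (norm (u n))\<^sup>2 - (norm (y n))\<^sup>2)"
    using storage_function_le_supplied_energy[OF S tr start, of K] by (simp add: interval)
  also have "\<dots> \<le> ereal ((\<Sum>n\<in>{- int K..-1}. (norm (u n))\<^sup>2) - (\<Sum>i\<in>I. (norm (out i))\<^sup>2))"
  proof -
    have y: "y i = out i" if "- int K \<le> i" for i
      using trajectory_output[OF tr, of "nat (i + int K)"] that by (simp add: start zero out_def)
    have "(\<Sum>i\<in>I. (norm (out i))\<^sup>2) = (\<Sum>i\<in>I \<inter> {- int K..-1}. (norm (out i))\<^sup>2)"
    proof (rule sum.mono_neutral_right[OF I(1)])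
      show "\<forall>i\<in>I - I \<inter> {- int K..-1}. (norm (out i))\<^sup>2 = 0"
      proof
        fix i assume "i \<in> I - I \<inter> {- int K..-1}"
        then have "{- int K..i} = {}"
          using I(2) by auto
        then show "(norm (out i))\<^sup>2 = 0"
          unfolding out_def by (simp only: sum.empty) simp
      qed
    qed auto
    also have "\<dots> \<le> (\<Sum>i\<in>{- int K..-1}. (norm (out i))\<^sup>2)"
      by (intro sum_mono2) auto
    finally show ?thesis
      by (simp add: sum_subtractf y)
  qed
  finally show ?thesis
    unfolding out_def .
qed

text \<open>The Fatou argument: the limit of large \<open>K\<close> is taken for a fixed finite set \<open>I\<close> of output times, and
  only then is the supremum over \<open>I\<close> formed, so the convergence of the outputs of the truncated inputs is
  needed pointwise only.\<close>
lemma storage_le_net_supply: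
  assumes S: "storage_function A B C D S" and st: "steers u x0"
    and lim: "(\<lambda>K. S (reached_state K u)) \<longlonglongrightarrow> S x0"
  shows "S x0 \<le> ereal (net_supply u)"
proof -
  note u = l2_neg_summable_atMost[OF steers_l2_neg[OF st]]
  have bound: "S x0 \<le> ereal ((l2_neg_norm u)\<^sup>2 - (\<Sum>i\<in>I. (norm (response u i))\<^sup>2))"
    if I: "finite I" "I \<subseteq> {..-1}" for I
  proof (rule LIMSEQ_le[OF lim])
    show "(\<lambda>K. ereal ((\<Sum>n\<in>{- int K..-1}. (norm (u n))\<^sup>2) -
        (\<Sum>i\<in>I. (norm (\<Sum>j\<in>{- int K..i}. F (nat (i - j)) (u j)))\<^sup>2)))
      \<longlonglongrightarrow> ereal ((l2_neg_norm u)\<^sup>2 - (\<Sum>i\<in>I. (norm (response u i))\<^sup>2))"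
      unfolding l2_neg_norm_squared lessThan_0_int using I
      by (intro tendsto_ereal tendsto_diff tendsto_sum tendsto_power tendsto_norm
          sum_int_interval_tendsto_infsum u truncated_response_tendsto summable_on_subset[OF u]) auto
  qed (use storage_reached_state_le[OF S I] in auto)
  have "0 \<le> S x0"
    using S by (simp add: storage_function_def)
  moreover have "S x0 \<le> ereal ((l2_neg_norm u)\<^sup>2)"
    using bound[of "{}"] by simp
  ultimately obtain s where s: "S x0 = ereal s"
    by (cases "S x0") auto
  have "s \<le> net_supply u"
  proof (rule le_net_supplyI[OF steers_l2_neg[OF st]])
    fix I :: "int set" assume "finite I" "I \<subseteq> {..<0}"
    then have "ereal s \<le> ereal ((l2_neg_norm u)\<^sup>2 - (\<Sum>i\<in>I. (norm (response u i))\<^sup>2))"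
      using bound[of I] by (simp only: s lessThan_0_int)
    then show "(\<Sum>i\<in>I. (norm (response u i))\<^sup>2) \<le> (l2_neg_norm u)\<^sup>2 - s"
      by simp
  qed
  then show ?thesis
    by (simp add: s)
qed

lemma steers_imp_Im_Wc: "steers u x0 \<Longrightarrow> x0 \<in> Im_Wc A B"
  unfolding steers_iff by blast

lemma storage_reached_state_tendsto:
  assumes cont: "dom_Wc_star_weakly_continuous A B S \<or> (Wc_bounded A B \<and> continuous_on UNIV S)"
    and st: "steers u x0"
  shows "(\<lambda>K. S (reached_state K u)) \<longlonglongrightarrow> S x0"
  using cont
proof
  assume weak: "dom_Wc_star_weakly_continuous A B S"
  have "\<And>K. reached_state K u \<in> Im_Wc A B"
    by (rule steers_imp_Im_Wc[OF steers_truncate])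
  moreover have "x0 \<in> Im_Wc A B"
    by (rule steers_imp_Im_Wc[OF st])
  ultimately show ?thesis
    by (intro weak[unfolded dom_Wc_star_weakly_continuous_def, rule_format]
        reached_state_weak_tendsto[OF st])
next
  assume "Wc_bounded A B \<and> continuous_on UNIV S"
  then show ?thesis
    using reached_state_tendsto[OF _ st] continuous_on_tendsto_compose[of UNIV S] by simp
qed

lemma storage_le_required_supply:
  assumes "storage_function A B C D S"
    and "dom_Wc_star_weakly_continuous A B S \<or> (Wc_bounded A B \<and> continuous_on UNIV S)"
  shows "S x0 \<le> l2_required_supply A B C D x0"
  unfolding l2_required_supply_def
proof (rule Inf_greatest, clarify)
  fix u assume "u \<in> dom_Wc A B"
  then have "steers u (Wc A B u)"
    unfolding steers_iff by simp
  then show "S (Wc A B u) \<le> ereal (net_supply u)"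
    by (intro storage_le_net_supply[OF assms(1)] storage_reached_state_tendsto[OF assms(2)])
qed

end

text \<open>Complex analysis enters here: it turns the Schur class continuation into the Toeplitz inequality.\<close>
lemma contractive_observable_systemI:
  assumes lin: "bounded_clinear A" "bounded_clinear B" "bounded_clinear C" "bounded_clinear D"
    and "minimal_system A B C"
    and "has_schur_continuation (transfer_function A B C D)"
  shows "contractive_observable_system A B C D"
proof
  obtain \<Phi> where \<Phi>: "\<Phi> \<in> schur_class" and near_0: "\<forall>\<^sub>F z in nhds 0. \<Phi> z = transfer_function A B C D z"
    using assms(6) unfolding has_schur_continuation_def by blast
  show "(\<Sum>n\<le>N. (norm (\<Sum>k\<le>n. markov A B C D (n - k) (u k)))\<^sup>2) \<le> (\<Sum>k\<le>N. (norm (u k))\<^sup>2)" for N u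
    by (rule schur_toeplitz_contraction_nat[OF \<Phi> schur_continuation_series[OF lin(1,3) \<Phi> near_0]])
qed (use assms in \<open>auto simp: minimal_system_def\<close>)

theorem proposition4p5:
  fixes A :: "'x :: complex_hilbert \<Rightarrow> 'x"
    and B :: "'u :: complex_hilbert \<Rightarrow> 'x"
    and C :: "'x \<Rightarrow> 'y :: complex_hilbert"
    and D :: "'u \<Rightarrow> 'y"
  assumes "bounded_clinear A" and "bounded_clinear B"
    and "bounded_clinear C" and "bounded_clinear D"
    and "minimal_system A B C"
    and "has_schur_continuation (transfer_function A B C D)"
  shows "(l2_regular_storage_function A B C D (available_storage A B C D) \<and>
          l2_regular_storage_function A B C D (l2_required_supply A B C D)) \<and>
         (\<forall>S. l2_regular_storage_function A B C D S \<and>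
              (dom_Wc_star_weakly_continuous A B S \<or>
               (Wc_bounded A B \<and> continuous_on UNIV S)) \<longrightarrow>
              (\<forall>x0. S x0 \<le> l2_required_supply A B C D x0))"
proof -
  interpret contractive_observable_system A B C D
    using assms by (rule contractive_observable_systemI)
  show ?thesis
    using l2_regular_available_storage l2_regular_required_supply storage_le_required_supply
    unfolding l2_regular_storage_function_def by blast
qed

end
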